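(* Let $\mathcal{C}$ be a small category, $J$ a Grothendieck topology on $\mathcal{C}$, and $L$ an intermediate logic presented by an axiom $\top\vdash_{\vec{x}}\top=\phi_{L}$, where $\phi_{L}$ is a term in $n$ variables in the theory of Heyting algebras. Then the Grothendieck topology $K\supseteq J$ on $\mathcal{C}$ corresponding to the $L$-topology on the topos $\mathbf{Sh}(\mathcal{C},J)$ is the Grothendieck topology on $\mathcal{C}$ generated over $J$ by the sieves of the form $f_{L}(S_{1},\ldots,S_{n})$, for any object $c\in\mathcal{C}$ and any $J$-closed sieves $S_{1},\ldots,S_{n}$ on $c$.
   Context: An intermediate logic $L$ is a propositional logic between intuitionistic and classical logic; here it is obtained from intuitionistic logic by adding a single axiom scheme, presented by a sequent $\top\vdash_{\vec{x}}\top=\phi_{L}(\vec{x})$ with $\phi_{L}$ a term in the signature of Heyting algebras (constants $0,1$, unary operation $\neg$, binary operations $\vee,\wedge,\Rightarrow$). For an elementary topos $\mathcal{E}$ with subobject classifier $\Omega$ (an internal Heyting algebra), let $f_{L}:\Omega^{n}\to\Omega$ be the interpretation of $\phi_{L}$ in $\Omega$ and $g_{L}:\Omega^{n}\to\Omega$ the composite of $\Omega^{n}\to 1$ with the truth value $\top:1\to\Omega$. The $L$-topology on $\mathcal{E}$ is the smallest local operator $j$ on $\mathcal{E}$ such that the equalizer of $f_{L}$ and $g_{L}$ is $j$-dense. A local operator $j$ on $\mathbf{Sh}(\mathcal{C},J)$ corresponds to the unique Grothendieck topology $K\supseteq J$ on $\mathcal{C}$ such that the inclusion $\mathbf{Sh}(\mathcal{C},K)\hookrightarrow\mathbf{Sh}(\mathcal{C},J)$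 is the subtopos $\mathbf{sh}_{j}(\mathbf{Sh}(\mathcal{C},J))$. The topology generated over $J$ by a family of sieves is the smallest Grothendieck topology containing $J$ and these sieves. The subobject classifier $\Omega_{J}$ of $\mathbf{Sh}(\mathcal{C},J)$ is given by $\Omega_{J}(c)=\{R \mid R \text{ a } J\text{-closed sieve on } c\}$, acting on arrows by pullback of sieves $f^{*}$. Its Heyting operations, in terms of which $f_{L}(S_{1},\ldots,S_{n})$ is computed at each object $c$, are: $0=\{f:d\to c\mid\emptyset\in J(d)\}$; $1$ is the maximal sieve on $c$; $S\wedge T=S\cap T$; $S\vee T=\{f:d\to c\mid f^{*}(S\cup T)\in J(d)\}$; $S\Rightarrow T=\{f:d\to c\mid f^{*}(S)\subseteq f^{*}(T)\}$; $\neg S=\{f:d\to c\mid\text{for all } g:e\to d,\ f\circ g\in S\text{ implies }\emptyset\in J(e)\}$. *)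

theory Defs
  imports "HOL-Library.FuncSet"
begin

section \<open>Propositional logics\<close>

text \<open>Propositional formulas are the same thing as terms in the signature of Heyting algebras.\<close>

datatype (vars: 'x) fm =
    Var 'x
  | Bot
  | Top
  | Neg "'x fm"
  | Or "'x fm" "'x fm"
  | And "'x fm" "'x fm"
  | Imp "'x fm" "'x fm"

primrec subst :: "('x \<Rightarrow> 'y fm) \<Rightarrow> 'x fm \<Rightarrow> 'y fm" where
  "subst \<sigma> (Var x) = \<sigma> x"
| "subst \<sigma> Bot = Bot"
| "subst \<sigma> Top = Top"
| "subst \<sigma> (Neg a) = Neg (subst \<sigma> a)"
| "subst \<sigma> (Or a b) = Or (subst \<sigma> a) (subst \<sigma> b)"
| "subst \<sigma> (And a b) = And (subst \<sigma> a) (subst \<sigma> b)"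
| "subst \<sigma> (Imp a b) = Imp (subst \<sigma> a) (subst \<sigma> b)"

text \<open>The logic obtained from intuitionistic propositional logic (in a Hilbert-style presentation)
  by adding all substitution instances of the members of \<open>\<Gamma>\<close> as axioms.\<close>

inductive_set ipl :: "nat fm set \<Rightarrow> nat fm set" for \<Gamma> where
  scheme: "\<phi> \<in> \<Gamma> \<Longrightarrow> subst \<sigma> \<phi> \<in> ipl \<Gamma>"
| mp: "Imp a b \<in> ipl \<Gamma> \<Longrightarrow> a \<in> ipl \<Gamma> \<Longrightarrow> b \<in> ipl \<Gamma>"
| K: "Imp a (Imp b a) \<in> ipl \<Gamma>"
| S: "Imp (Imp a (Imp b d)) (Imp (Imp a b) (Imp a d)) \<in> ipl \<Gamma>"
| andE1: "Imp (And a b) a \<in> ipl \<Gamma>"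
| andE2: "Imp (And a b) b \<in> ipl \<Gamma>"
| andI: "Imp a (Imp b (And a b)) \<in> ipl \<Gamma>"
| orI1: "Imp a (Or a b) \<in> ipl \<Gamma>"
| orI2: "Imp b (Or a b) \<in> ipl \<Gamma>"
| orE: "Imp (Imp a d) (Imp (Imp b d) (Imp (Or a b) d)) \<in> ipl \<Gamma>"
| botE: "Imp Bot a \<in> ipl \<Gamma>"
| topI: "Top \<in> ipl \<Gamma>"
| negE: "Imp (Neg a) (Imp a Bot) \<in> ipl \<Gamma>"
| negI: "Imp (Imp a Bot) (Neg a) \<in> ipl \<Gamma>"

definition intuitionistic_logic :: "nat fm set" where
  "intuitionistic_logic = ipl {}"

definition classical_logic :: "nat fm set" where
  "classical_logic = ipl {Or (Var 0) (Neg (Var 0))}"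

text \<open>\<open>L\<close> is an intermediate logic presented by the single axiom \<open>\<phi>\<close> in the variables
  \<open>Var 0, \<dots>, Var (n - 1)\<close>.\<close>

definition presents_intermediate_logic :: "nat \<Rightarrow> nat fm \<Rightarrow> nat fm set \<Rightarrow> bool" where
  "presents_intermediate_logic n \<phi> L \<longleftrightarrow>
     vars \<phi> \<subseteq> {..<n} \<and> L = ipl {\<phi>} \<and>
     intuitionistic_logic \<subseteq> L \<and> L \<subseteq> classical_logic"

section \<open>Small categories\<close>

record ('o, 'a) cat =
  Obj :: "'o set"
  Arr :: "'a set"
  Dom :: "'a \<Rightarrow> 'o"
  Cod :: "'a \<Rightarrow> 'o"
  Id :: "'o \<Rightarrow> 'a"
  Comp :: "'a \<Rightarrow> 'a \<Rightarrow> 'a"  \<comment> \<open>\<open>Comp f g\<close> is \<open>f\<close> after \<open>g\<close>\<close>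

locale category =
  fixes C :: "('o, 'a) cat"
  assumes dom_obj: "f \<in> Arr C \<Longrightarrow> Dom C f \<in> Obj C"
    and cod_obj: "f \<in> Arr C \<Longrightarrow> Cod C f \<in> Obj C"
    and id_arr: "c \<in> Obj C \<Longrightarrow> Id C c \<in> Arr C \<and> Dom C (Id C c) = c \<and> Cod C (Id C c) = c"
    and comp_arr: "\<lbrakk>f \<in> Arr C; g \<in> Arr C; Cod C g = Dom C f\<rbrakk> \<Longrightarrow>
      Comp C f g \<in> Arr C \<and> Dom C (Comp C f g) = Dom C g \<and> Cod C (Comp C f g) = Cod C f"
    and comp_id_left: "f \<in> Arr C \<Longrightarrow> Comp C (Id C (Cod C f)) f = f"
    and comp_id_right: "f \<in> Arr C \<Longrightarrow> Comp C f (Id C (Dom C f)) = f"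
    and comp_assoc: "\<lbrakk>f \<in> Arr C; g \<in> Arr C; h \<in> Arr C; Cod C g = Dom C f; Cod C h = Dom C g\<rbrakk> \<Longrightarrow>
      Comp C (Comp C f g) h = Comp C f (Comp C g h)"

section \<open>Sieves and Grothendieck topologies\<close>

definition max_sieve :: "('o, 'a) cat \<Rightarrow> 'o \<Rightarrow> 'a set" where
  "max_sieve C c = {f \<in> Arr C. Cod C f = c}"

definition sieve :: "('o, 'a) cat \<Rightarrow> 'o \<Rightarrow> 'a set \<Rightarrow> bool" where
  "sieve C c R \<longleftrightarrow> R \<subseteq> max_sieve C c \<and>
     (\<forall>f\<in>R. \<forall>g\<in>max_sieve C (Dom C f). Comp C f g \<in> R)"

definition pull :: "('o, 'a) cat \<Rightarrow> 'a \<Rightarrow> 'a set \<Rightarrow> 'a set" where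
  "pull C f R = {g \<in> max_sieve C (Dom C f). Comp C f g \<in> R}"

text \<open>A topology is a set of pairs \<open>(c, R)\<close>, meaning that \<open>R \<in> J(c)\<close>. The object has to be kept,
  since the empty sieve lives on every object.\<close>

definition grothendieck_topology :: "('o, 'a) cat \<Rightarrow> ('o \<times> 'a set) set \<Rightarrow> bool" where
  "grothendieck_topology C J \<longleftrightarrow>
     (\<forall>(c, R)\<in>J. c \<in> Obj C \<and> sieve C c R) \<and>
     (\<forall>c\<in>Obj C. (c, max_sieve C c) \<in> J) \<and>
     (\<forall>(c, R)\<in>J. \<forall>f\<in>max_sieve C c. (Dom C f, pull C f R) \<in> J) \<and>
     (\<forall>(c, R)\<in>J. \<forall>S. sieve C c S \<longrightarrow> (\<forall>f\<in>R. (Dom C f, pull C f S) \<in> J) \<longrightarrow> (c, S) \<in> J)"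

definition generated_topology ::
  "('o, 'a) cat \<Rightarrow> ('o \<times> 'a set) set \<Rightarrow> ('o \<times> 'a set) set \<Rightarrow> ('o \<times> 'a set) set" where
  "generated_topology C J G = \<Inter>{K. grothendieck_topology C K \<and> J \<subseteq> K \<and> G \<subseteq> K}"

definition closed_sieve :: "('o, 'a) cat \<Rightarrow> ('o \<times> 'a set) set \<Rightarrow> 'o \<Rightarrow> 'a set \<Rightarrow> bool" where
  "closed_sieve C J c S \<longleftrightarrow> sieve C c S \<and>
     (\<forall>f\<in>max_sieve C c. (Dom C f, pull C f S) \<in> J \<longrightarrow> f \<in> S)"

section \<open>Presheaves and sheaves\<close>

text \<open>HOL has no category of all sets. Presheaves take subsets of a type \<open>'v\<close> as values, which
  plays the role of a universe of sets.\<close>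

record ('o, 'a, 'v) psh =
  pobj :: "'o \<Rightarrow> 'v set"
  pmap :: "'a \<Rightarrow> 'v \<Rightarrow> 'v"

definition presheaf :: "('o, 'a) cat \<Rightarrow> ('o, 'a, 'v) psh \<Rightarrow> bool" where
  "presheaf C F \<longleftrightarrow>
     (\<forall>f\<in>Arr C. pmap F f \<in> pobj F (Cod C f) \<rightarrow> pobj F (Dom C f)) \<and>
     (\<forall>c\<in>Obj C. \<forall>x\<in>pobj F c. pmap F (Id C c) x = x) \<and>
     (\<forall>f\<in>Arr C. \<forall>g\<in>max_sieve C (Dom C f). \<forall>x\<in>pobj F (Cod C f).
        pmap F (Comp C f g) x = pmap F g (pmap F f x))"

definition matching_family :: "('o, 'a) cat \<Rightarrow> ('o, 'a, 'v) psh \<Rightarrow> 'a set \<Rightarrow> ('a \<Rightarrow> 'v) \<Rightarrow> bool" where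
  "matching_family C F R x \<longleftrightarrow>
     (\<forall>f\<in>R. x f \<in> pobj F (Dom C f)) \<and>
     (\<forall>f\<in>R. \<forall>g\<in>max_sieve C (Dom C f). pmap F g (x f) = x (Comp C f g))"

definition Sh :: "('o, 'a) cat \<Rightarrow> ('o \<times> 'a set) set \<Rightarrow> ('o, 'a, 'v) psh set" where
  "Sh C J = {F. presheaf C F \<and>
     (\<forall>(c, R)\<in>J. \<forall>x. matching_family C F R x \<longrightarrow> (\<exists>!y. y \<in> pobj F c \<and> (\<forall>f\<in>R. pmap F f y = x f)))}"

text \<open>Natural transformations are extensional, so that they are equal if and only if they have the
  same components.\<close>

definition nat_trans ::
  "('o, 'a) cat \<Rightarrow> ('o, 'a, 'v) psh \<Rightarrow> ('o, 'a, 'w) psh \<Rightarrow> ('o \<Rightarrow> 'v \<Rightarrow> 'w) set" where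
  "nat_trans C F G = {\<eta> \<in> (\<Pi>\<^sub>E c\<in>Obj C. pobj F c \<rightarrow>\<^sub>E pobj G c).
     \<forall>f\<in>Arr C. \<forall>x\<in>pobj F (Cod C f). \<eta> (Dom C f) (pmap F f x) = pmap G f (\<eta> (Cod C f) x)}"

definition nat_comp ::
  "('o, 'a) cat \<Rightarrow> ('o, 'a, 'v) psh \<Rightarrow> ('o \<Rightarrow> 'w \<Rightarrow> 'z) \<Rightarrow> ('o \<Rightarrow> 'v \<Rightarrow> 'w) \<Rightarrow> 'o \<Rightarrow> 'v \<Rightarrow> 'z" where
  "nat_comp C F \<theta> \<eta> = (\<lambda>c\<in>Obj C. \<lambda>x\<in>pobj F c. \<theta> c (\<eta> c x))"

definition terminal :: "('o, 'a, unit) psh" where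
  "terminal = \<lparr>pobj = (\<lambda>_. {()}), pmap = (\<lambda>_ _. ())\<rparr>"

definition to_terminal :: "('o, 'a) cat \<Rightarrow> ('o, 'a, 'v) psh \<Rightarrow> 'o \<Rightarrow> 'v \<Rightarrow> unit" where
  "to_terminal C F = (\<lambda>c\<in>Obj C. \<lambda>x\<in>pobj F c. ())"

text \<open>The \<open>n\<close>-fold power of a presheaf; tuples are lists of length \<open>n\<close>.\<close>

definition power_psh :: "nat \<Rightarrow> ('o, 'a, 'v) psh \<Rightarrow> ('o, 'a, 'v list) psh" where
  "power_psh n F = \<lparr>pobj = (\<lambda>c. {xs. length xs = n \<and> set xs \<subseteq> pobj F c}),
     pmap = (\<lambda>f. map (pmap F f))\<rparr>"

definition equalizer ::
  "('o, 'a, 'v) psh \<Rightarrow> ('o \<Rightarrow> 'v \<Rightarrow> 'w) \<Rightarrow> ('o \<Rightarrow> 'v \<Rightarrow> 'w) \<Rightarrow> 'o \<Rightarrow> 'v set" where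
  "equalizer F \<eta> \<theta> = (\<lambda>c. {x \<in> pobj F c. \<eta> c x = \<theta> c x})"

text \<open>Subobjects of a sheaf \<open>B\<close> are represented by subsheaves: families of subsets that form a
  sheaf with the restricted action of \<open>B\<close>.\<close>

definition subsheaf ::
  "('o, 'a) cat \<Rightarrow> ('o \<times> 'a set) set \<Rightarrow> ('o, 'a, 'v) psh \<Rightarrow> ('o \<Rightarrow> 'v set) \<Rightarrow> bool" where
  "subsheaf C J B A \<longleftrightarrow> (\<forall>c\<in>Obj C. A c \<subseteq> pobj B c) \<and> B\<lparr>pobj := A\<rparr> \<in> Sh C J"

section \<open>The subobject classifier and its Heyting operations\<close>

definition Omega :: "('o, 'a) cat \<Rightarrow> ('o \<times> 'a set) set \<Rightarrow> ('o, 'a, 'a set) psh" where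
  "Omega C J = \<lparr>pobj = (\<lambda>c. {S. closed_sieve C J c S}), pmap = pull C\<rparr>"

definition truth :: "('o, 'a) cat \<Rightarrow> 'o \<Rightarrow> unit \<Rightarrow> 'a set" where
  "truth C = (\<lambda>c\<in>Obj C. \<lambda>x\<in>{()}. max_sieve C c)"

definition char_map :: "('o, 'a) cat \<Rightarrow> ('o, 'a, 'v) psh \<Rightarrow> ('o \<Rightarrow> 'v set) \<Rightarrow> 'o \<Rightarrow> 'v \<Rightarrow> 'a set" where
  "char_map C B A = (\<lambda>c\<in>Obj C. \<lambda>x\<in>pobj B c. {f \<in> max_sieve C c. pmap B f x \<in> A (Dom C f)})"

definition h_bot :: "('o, 'a) cat \<Rightarrow> ('o \<times> 'a set) set \<Rightarrow> 'o \<Rightarrow> 'a set" where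
  "h_bot C J c = {f \<in> max_sieve C c. (Dom C f, {}) \<in> J}"

definition h_or :: "('o, 'a) cat \<Rightarrow> ('o \<times> 'a set) set \<Rightarrow> 'o \<Rightarrow> 'a set \<Rightarrow> 'a set \<Rightarrow> 'a set" where
  "h_or C J c S T = {f \<in> max_sieve C c. (Dom C f, pull C f (S \<union> T)) \<in> J}"

definition h_imp :: "('o, 'a) cat \<Rightarrow> 'o \<Rightarrow> 'a set \<Rightarrow> 'a set \<Rightarrow> 'a set" where
  "h_imp C c S T = {f \<in> max_sieve C c. pull C f S \<subseteq> pull C f T}"

definition h_neg :: "('o, 'a) cat \<Rightarrow> ('o \<times> 'a set) set \<Rightarrow> 'o \<Rightarrow> 'a set \<Rightarrow> 'a set" where
  "h_neg C J c S = {f \<in> max_sieve C c.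
     \<forall>g\<in>max_sieve C (Dom C f). Comp C f g \<in> S \<longrightarrow> (Dom C g, {}) \<in> J}"

primrec interp ::
  "('o, 'a) cat \<Rightarrow> ('o \<times> 'a set) set \<Rightarrow> 'o \<Rightarrow> 'a set list \<Rightarrow> nat fm \<Rightarrow> 'a set" where
  "interp C J c Ss (Var i) = Ss ! i"
| "interp C J c Ss Bot = h_bot C J c"
| "interp C J c Ss Top = max_sieve C c"
| "interp C J c Ss (Neg a) = h_neg C J c (interp C J c Ss a)"
| "interp C J c Ss (Or a b) = h_or C J c (interp C J c Ss a) (interp C J c Ss b)"
| "interp C J c Ss (And a b) = interp C J c Ss a \<inter> interp C J c Ss b"
| "interp C J c Ss (Imp a b) = h_imp C c (interp C J c Ss a) (interp C J c Ss b)"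

text \<open>The arrows \<open>f\<^sub>L\<close> and \<open>g\<^sub>L\<close> from the \<open>n\<close>-th power of the subobject classifier to itself.\<close>

definition f_map ::
  "('o, 'a) cat \<Rightarrow> ('o \<times> 'a set) set \<Rightarrow> nat \<Rightarrow> nat fm \<Rightarrow> 'o \<Rightarrow> 'a set list \<Rightarrow> 'a set" where
  "f_map C J n \<phi> = (\<lambda>c\<in>Obj C. \<lambda>Ss\<in>pobj (power_psh n (Omega C J)) c. interp C J c Ss \<phi>)"

definition g_map ::
  "('o, 'a) cat \<Rightarrow> ('o \<times> 'a set) set \<Rightarrow> nat \<Rightarrow> 'o \<Rightarrow> 'a set list \<Rightarrow> 'a set" where
  "g_map C J n = (let P = power_psh n (Omega C J) in nat_comp C P (truth C) (to_terminal C P))"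

section \<open>Local operators\<close>

definition local_operator ::
  "('o, 'a) cat \<Rightarrow> ('o \<times> 'a set) set \<Rightarrow> ('o \<Rightarrow> 'a set \<Rightarrow> 'a set) \<Rightarrow> bool" where
  "local_operator C J j \<longleftrightarrow>
     j \<in> nat_trans C (Omega C J) (Omega C J) \<and>
     (\<forall>c\<in>Obj C. j c (max_sieve C c) = max_sieve C c) \<and>
     (\<forall>c\<in>Obj C. \<forall>S\<in>pobj (Omega C J) c. j c (j c S) = j c S) \<and>
     (\<forall>c\<in>Obj C. \<forall>S\<in>pobj (Omega C J) c. \<forall>T\<in>pobj (Omega C J) c. j c (S \<inter> T) = j c S \<inter> j c T)"

text \<open>The order on local operators induced by the order of the internal Heyting algebra.\<close>

definition local_operator_le ::
  "('o, 'a) cat \<Rightarrow> ('o \<times> 'a set) set \<Rightarrow> ('o \<Rightarrow> 'a set \<Rightarrow> 'a set) \<Rightarrow> ('o \<Rightarrow> 'a set \<Rightarrow> 'a set) \<Rightarrow> bool" where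
  "local_operator_le C J j j' \<longleftrightarrow> (\<forall>c\<in>Obj C. \<forall>S\<in>pobj (Omega C J) c. j c S \<subseteq> j' c S)"

text \<open>The closure of \<open>A\<close> is the subobject of \<open>B\<close> classified by \<open>j\<close> after the classifying map
  of \<open>A\<close>.\<close>

definition j_closure ::
  "('o, 'a) cat \<Rightarrow> ('o \<Rightarrow> 'a set \<Rightarrow> 'a set) \<Rightarrow> ('o, 'a, 'v) psh \<Rightarrow> ('o \<Rightarrow> 'v set) \<Rightarrow> 'o \<Rightarrow> 'v set" where
  "j_closure C j B A = (\<lambda>c. {x \<in> pobj B c. nat_comp C B j (char_map C B A) c x = max_sieve C c})"

definition j_dense ::
  "('o, 'a) cat \<Rightarrow> ('o \<Rightarrow> 'a set \<Rightarrow> 'a set) \<Rightarrow> ('o, 'a, 'v) psh \<Rightarrow> ('o \<Rightarrow> 'v set) \<Rightarrow> bool" where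
  "j_dense C j B A \<longleftrightarrow> (\<forall>c\<in>Obj C. j_closure C j B A c = pobj B c)"

text \<open>The objects of the subtopos of \<open>j\<close>-sheaves, a full subcategory of the category of
  \<open>J\<close>-sheaves.\<close>

definition sh_sub ::
  "('o, 'a) cat \<Rightarrow> ('o \<times> 'a set) set \<Rightarrow> ('o \<Rightarrow> 'a set \<Rightarrow> 'a set) \<Rightarrow> ('o, 'a, 'v) psh set" where
  "sh_sub C J j = {F \<in> Sh C J. \<forall>(B :: ('o, 'a, 'v) psh) A.
     B \<in> Sh C J \<and> subsheaf C J B A \<and> j_dense C j B A \<longrightarrow>
     (\<forall>h\<in>nat_trans C (B\<lparr>pobj := A\<rparr>) F.
        \<exists>!k. k \<in> nat_trans C B F \<and> (\<forall>c\<in>Obj C. \<forall>x\<in>A c. k c x = h c x))}"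

text \<open>The Grothendieck topology \<open>K\<close> corresponds to the local operator \<open>j\<close>. Both sides of the last
  equation are full subcategories closed under isomorphism, so they are the same subtopos if and
  only if they have the same objects. The first argument fixes the type of values of sheaves.\<close>

definition corresponds ::
  "'v itself \<Rightarrow> ('o, 'a) cat \<Rightarrow> ('o \<times> 'a set) set \<Rightarrow> ('o \<Rightarrow> 'a set \<Rightarrow> 'a set) \<Rightarrow>
     ('o \<times> 'a set) set \<Rightarrow> bool" where
  "corresponds (_ :: 'v itself) C J j K \<longleftrightarrow>
     grothendieck_topology C K \<and> J \<subseteq> K \<and> (Sh C K :: ('o, 'a, 'v) psh set) = sh_sub C J j"

text \<open>With too few values (say, \<open>'v\<close> a singleton) sheaves cannot distinguish topologies. An
  element of the sheafification of a representable presheaf, as well as an element of the subobject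
  classifier, can be coded by a set of pairs of arrows; so the following asks that \<open>'v\<close> be large
  enough to contain these sheaves up to isomorphism.\<close>

definition large_enough :: "'v itself \<Rightarrow> 'a itself \<Rightarrow> bool" where
  "large_enough (_ :: 'v itself) (_ :: 'a itself) \<longleftrightarrow> (\<exists>\<iota> :: ('a \<times> 'a) set \<Rightarrow> 'v. inj \<iota>)"

section \<open>The topology of an intermediate logic\<close>

definition equalizer_dense ::
  "('o, 'a) cat \<Rightarrow> ('o \<times> 'a set) set \<Rightarrow> nat \<Rightarrow> nat fm \<Rightarrow> ('o \<Rightarrow> 'a set \<Rightarrow> 'a set) \<Rightarrow> bool" where
  "equalizer_dense C J n \<phi> j \<longleftrightarrow>
     (let P = power_psh n (Omega C J)
      in j_dense C j P (equalizer P (f_map C J n \<phi>) (g_map C J n)))"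

definition is_L_topology ::
  "('o, 'a) cat \<Rightarrow> ('o \<times> 'a set) set \<Rightarrow> nat \<Rightarrow> nat fm \<Rightarrow> ('o \<Rightarrow> 'a set \<Rightarrow> 'a set) \<Rightarrow> bool" where
  "is_L_topology C J n \<phi> j \<longleftrightarrow>
     local_operator C J j \<and> equalizer_dense C J n \<phi> j \<and>
     (\<forall>j'. local_operator C J j' \<and> equalizer_dense C J n \<phi> j' \<longrightarrow> local_operator_le C J j j')"

end

theory Submission
  imports Defs
begin

text \<open>A local operator \<open>j\<close> on the topos of \<open>J\<close>-sheaves is the same thing as a topology above \<open>J\<close>: from \<open>j\<close>
  one obtains the topology of the sieves whose \<open>J\<close>-closure has maximal \<open>j\<close>-closure, and from a topology \<open>K\<close> the
  operation of \<open>K\<close>-closure on \<open>J\<close>-closed sieves. These passages are mutually inverse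
  (\<open>local_operator_eq_dense\<close>, \<open>dense_sieves_closure_operator\<close>) and preserve the order
  (\<open>local_operator_le_iff\<close>).

  The operations on closed sieves are natural, so the classifying map of the equalizer of \<open>f\<^sub>L\<close> and \<open>g\<^sub>L\<close> is \<open>f\<^sub>L\<close>
  itself. The equalizer is therefore \<open>j\<close>-dense if and only if all sieves \<open>f\<^sub>L(S\<^sub>1, \<dots>, S\<^sub>n)\<close> belong to the topology
  of \<open>j\<close> (\<open>equalizer_dense_iff\<close>). The least such \<open>j\<close> thus exists and belongs to the topology
  generated over \<open>J\<close> by these sieves.

  It remains to see that the topology of \<open>j\<close> in this sense is the one that corresponds to \<open>j\<close> by having the same
  sheaves. A sheaf for the dense sieves is a \<open>j\<close>-sheaf, by gluing along the sieves on which an element of the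
  larger sheaf lies in the dense subsheaf (\<open>Sh_dense_sieves_subset\<close>). Conversely, a \<open>j\<close>-sheaf is tested
  against the inclusion of a sheafified dense sieve in the sheafified representable
  (\<open>sh_sub_subset_Sh_dense_sieves\<close>). Finally a topology is determined by its sheaves, because its
  subobject classifier is one of them (\<open>topology_subset_if_Sh_subset\<close>).\<close>

section \<open>Sieves\<close>

context category
begin

lemma in_max_sieve [simp]: "f \<in> max_sieve C c \<longleftrightarrow> f \<in> Arr C \<and> Cod C f = c"
  by (simp add: max_sieve_def)

lemma
  assumes "f \<in> Arr C" "g \<in> Arr C" "Cod C g = Dom C f"
  shows arr_comp [simp]: "Comp C f g \<in> Arr C"
    and dom_comp [simp]: "Dom C (Comp C f g) = Dom C g"
    and cod_comp [simp]: "Cod C (Comp C f g) = Cod C f"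
  using comp_arr[OF assms] by auto

lemma
  assumes "c \<in> Obj C"
  shows arr_id [simp]: "Id C c \<in> Arr C"
    and dom_id [simp]: "Dom C (Id C c) = c"
    and cod_id [simp]: "Cod C (Id C c) = c"
  using id_arr[OF assms] by auto

declare dom_obj [simp] cod_obj [simp] comp_assoc [simp]

lemma comp_id_left' [simp]: "f \<in> Arr C \<Longrightarrow> Cod C f = c \<Longrightarrow> Comp C (Id C c) f = f"
  using comp_id_left by auto

lemma comp_id_right' [simp]: "f \<in> Arr C \<Longrightarrow> Dom C f = c \<Longrightarrow> Comp C f (Id C c) = f"
  using comp_id_right by auto

lemma in_pull [simp]:
  "g \<in> pull C f R \<longleftrightarrow> g \<in> Arr C \<and> Cod C g = Dom C f \<and> Comp C f g \<in> R"
  by (auto simp: pull_def)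

lemma sieveI:
  assumes "\<And>f. f \<in> R \<Longrightarrow> f \<in> Arr C \<and> Cod C f = c"
    and "\<And>f g. f \<in> R \<Longrightarrow> g \<in> Arr C \<Longrightarrow> Cod C g = Dom C f \<Longrightarrow> Comp C f g \<in> R"
  shows "sieve C c R"
  using assms by (auto simp: sieve_def)

lemma sieve_arr: "sieve C c R \<Longrightarrow> f \<in> R \<Longrightarrow> f \<in> Arr C \<and> Cod C f = c"
  by (auto simp: sieve_def)

lemma sieve_comp:
  "sieve C c R \<Longrightarrow> f \<in> R \<Longrightarrow> g \<in> Arr C \<Longrightarrow> Cod C g = Dom C f \<Longrightarrow> Comp C f g \<in> R"
  by (auto simp: sieve_def)

lemma sieve_max [simp]: "sieve C c (max_sieve C c)"
  by (rule sieveI) auto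

lemma sieve_pull: "sieve C c R \<Longrightarrow> f \<in> max_sieve C c \<Longrightarrow> sieve C (Dom C f) (pull C f R)"
  by (rule sieveI) (auto dest: sieve_comp simp flip: comp_assoc)

lemma pull_comp:
  "f \<in> Arr C \<Longrightarrow> g \<in> Arr C \<Longrightarrow> Cod C g = Dom C f \<Longrightarrow>
     pull C (Comp C f g) R = pull C g (pull C f R)"
  by (auto simp: pull_def)

lemma pull_id: "sieve C c R \<Longrightarrow> c \<in> Obj C \<Longrightarrow> pull C (Id C c) R = R"
  by (auto dest: sieve_arr)

lemma pull_max: "f \<in> max_sieve C c \<Longrightarrow> pull C f (max_sieve C c) = max_sieve C (Dom C f)"
  by auto

lemma sieve_eq_max_iff:
  "sieve C c R \<Longrightarrow> c \<in> Obj C \<Longrightarrow> R = max_sieve C c \<longleftrightarrow> Id C c \<in> R"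
  using sieve_comp[of c R "Id C c"] by (auto dest: sieve_arr)

lemma pull_eq_max_iff:
  assumes "sieve C c R" "f \<in> max_sieve C c"
  shows "pull C f R = max_sieve C (Dom C f) \<longleftrightarrow> f \<in> R"
  using sieve_eq_max_iff[OF sieve_pull[OF assms]] assms by simp

section \<open>Natural transformations\<close>

lemma nat_trans_in:
  "\<eta> \<in> nat_trans C F G \<Longrightarrow> c \<in> Obj C \<Longrightarrow> x \<in> pobj F c \<Longrightarrow> \<eta> c x \<in> pobj G c"
  unfolding nat_trans_def by (blast dest: PiE_mem)

lemma nat_trans_natural:
  "\<eta> \<in> nat_trans C F G \<Longrightarrow> f \<in> Arr C \<Longrightarrow> x \<in> pobj F (Cod C f) \<Longrightarrow>
     \<eta> (Dom C f) (pmap F f x) = pmap G f (\<eta> (Cod C f) x)"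
  unfolding nat_trans_def by blast

lemma nat_trans_eqI:
  assumes "\<eta> \<in> nat_trans C F G" "\<theta> \<in> nat_trans C F G"
    and "\<And>c x. c \<in> Obj C \<Longrightarrow> x \<in> pobj F c \<Longrightarrow> \<eta> c x = \<theta> c x"
  shows "\<eta> = \<theta>"
proof -
  have P: "\<eta> \<in> (\<Pi>\<^sub>E c\<in>Obj C. pobj F c \<rightarrow>\<^sub>E pobj G c)"
    and P': "\<theta> \<in> (\<Pi>\<^sub>E c\<in>Obj C. pobj F c \<rightarrow>\<^sub>E pobj G c)"
    using assms(1,2) by (auto simp: nat_trans_def)
  show ?thesis
    by (rule PiE_ext[OF P P'], rule PiE_ext[OF PiE_mem[OF P] PiE_mem[OF P']]) (auto intro: assms(3))
qed

lemma nat_transI: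
  assumes "\<And>c x. c \<in> Obj C \<Longrightarrow> x \<in> pobj F c \<Longrightarrow> t c x \<in> pobj G c"
    and "\<And>f x. f \<in> Arr C \<Longrightarrow> x \<in> pobj F (Cod C f) \<Longrightarrow> pmap F f x \<in> pobj F (Dom C f)"
    and "\<And>f x. f \<in> Arr C \<Longrightarrow> x \<in> pobj F (Cod C f) \<Longrightarrow>
      t (Dom C f) (pmap F f x) = pmap G f (t (Cod C f) x)"
  shows "(\<lambda>c\<in>Obj C. \<lambda>x\<in>pobj F c. t c x) \<in> nat_trans C F G"
  using assms by (simp add: nat_trans_def)

end

section \<open>Closures of sieves\<close>

text \<open>Taking \<open>J\<close>-closures of sieves for one topology and for a larger one is the common language of
  the proof: the operations of the subobject classifier and the local operators are both closures.\<close>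

definition sieve_closure :: "('o, 'a) cat \<Rightarrow> ('o \<times> 'a set) set \<Rightarrow> 'o \<Rightarrow> 'a set \<Rightarrow> 'a set" where
  "sieve_closure C J c R = {f \<in> max_sieve C c. (Dom C f, pull C f R) \<in> J}"

locale site = category C for C :: "('o, 'a) cat" +
  fixes J :: "('o \<times> 'a set) set"
  assumes topology: "grothendieck_topology C J"
begin

lemma cover_obj: "(c, R) \<in> J \<Longrightarrow> c \<in> Obj C"
  and cover_sieve: "(c, R) \<in> J \<Longrightarrow> sieve C c R"
  and cover_max: "c \<in> Obj C \<Longrightarrow> (c, max_sieve C c) \<in> J"
  and cover_pull: "(c, R) \<in> J \<Longrightarrow> f \<in> max_sieve C c \<Longrightarrow> (Dom C f, pull C f R) \<in> J"
  and cover_trans: "(c, R) \<in> J \<Longrightarrow> sieve C c S \<Longrightarrow>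
    (\<And>f. f \<in> R \<Longrightarrow> (Dom C f, pull C f S) \<in> J) \<Longrightarrow> (c, S) \<in> J"
  using topology unfolding grothendieck_topology_def by blast+

lemma cover_if_id: "sieve C c R \<Longrightarrow> c \<in> Obj C \<Longrightarrow> Id C c \<in> R \<Longrightarrow> (c, R) \<in> J"
  using sieve_eq_max_iff cover_max by metis

lemma cover_pull_if_mem: "sieve C c R \<Longrightarrow> f \<in> R \<Longrightarrow> (Dom C f, pull C f R) \<in> J"
  using pull_eq_max_iff[of c R f] cover_max sieve_arr[of c R f] by simp

lemma cover_mono: "(c, R) \<in> J \<Longrightarrow> sieve C c S \<Longrightarrow> R \<subseteq> S \<Longrightarrow> (c, S) \<in> J"
  by (rule cover_trans) (auto intro: cover_pull_if_mem)

lemma cover_Int: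
  assumes "(c, R) \<in> J" "(c, S) \<in> J"
  shows "(c, R \<inter> S) \<in> J"
proof (rule cover_trans[OF assms(1)])
  show sv: "sieve C c (R \<inter> S)"
    using cover_sieve[OF assms(1)] cover_sieve[OF assms(2)] by (auto simp: sieve_def)
  fix f assume f: "f \<in> R"
  then have fm: "f \<in> max_sieve C c" using sieve_arr[OF cover_sieve[OF assms(1)]] by simp
  have "pull C f S \<subseteq> pull C f (R \<inter> S)"
    using sieve_comp[OF cover_sieve[OF assms(1)] f] by auto
  then show "(Dom C f, pull C f (R \<inter> S)) \<in> J"
    using cover_mono[OF cover_pull[OF assms(2) fm] sieve_pull[OF sv fm]] by blast
qed

lemma sieve_closure_sieve:
  assumes "sieve C c R" shows "sieve C c (sieve_closure C J c R)"
proof (rule sieveI)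
  fix f g assume "f \<in> sieve_closure C J c R" "g \<in> Arr C" "Cod C g = Dom C f"
  then show "Comp C f g \<in> sieve_closure C J c R"
    using cover_pull[of "Dom C f" "pull C f R" g] by (auto simp: sieve_closure_def pull_comp)
qed (auto simp: sieve_closure_def)

lemma sieve_closure_subset: "sieve C c R \<Longrightarrow> R \<subseteq> sieve_closure C J c R"
  by (auto simp: sieve_closure_def cover_pull_if_mem dest: sieve_arr)

lemma closed_sieveD: "closed_sieve C J c S \<Longrightarrow> f \<in> Arr C \<Longrightarrow> Cod C f = c \<Longrightarrow>
    (Dom C f, pull C f S) \<in> J \<Longrightarrow> f \<in> S"
  by (auto simp: closed_sieve_def)

lemma sieve_closure_closed:
  assumes "sieve C c R" shows "closed_sieve C J c (sieve_closure C J c R)"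
  unfolding closed_sieve_def
proof (intro conjI ballI impI)
  fix f assume f: "f \<in> max_sieve C c" "(Dom C f, pull C f (sieve_closure C J c R)) \<in> J"
  have "(Dom C f, pull C f R) \<in> J"
    by (rule cover_trans[OF f(2) sieve_pull[OF assms f(1)]])
      (use f(1) in \<open>auto simp: sieve_closure_def pull_comp\<close>)
  then show "f \<in> sieve_closure C J c R" using f by (simp add: sieve_closure_def)
qed (rule sieve_closure_sieve[OF assms])

lemma sieve_closure_mono:
  assumes "sieve C c R" "sieve C c S" "R \<subseteq> S"
  shows "sieve_closure C J c R \<subseteq> sieve_closure C J c S"
proof
  fix f assume f: "f \<in> sieve_closure C J c R"
  then have "sieve C (Dom C f) (pull C f S)" by (auto simp: sieve_closure_def intro: sieve_pull assms)
  with f assms(3) show "f \<in> sieve_closure C J c S"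
    by (auto simp: sieve_closure_def elim!: cover_mono)
qed

lemma sieve_closure_id: "closed_sieve C J c S \<Longrightarrow> sieve_closure C J c S = S"
  using sieve_closure_subset[of c S] by (auto simp: closed_sieve_def sieve_closure_def)

lemma pull_sieve_closure:
  "f \<in> max_sieve C c \<Longrightarrow>
     pull C f (sieve_closure C J c R) = sieve_closure C J (Dom C f) (pull C f R)"
  by (auto simp: sieve_closure_def pull_comp)

lemma sieve_closure_eq_max_iff:
  assumes "sieve C c R" "c \<in> Obj C"
  shows "sieve_closure C J c R = max_sieve C c \<longleftrightarrow> (c, R) \<in> J"
  using sieve_eq_max_iff[OF sieve_closure_sieve[OF assms(1)] assms(2)] assms
  by (simp add: sieve_closure_def pull_id)

lemma closed_sieve_pull:
  assumes "closed_sieve C J c S" "f \<in> max_sieve C c"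
  shows "closed_sieve C J (Dom C f) (pull C f S)"
  using assms sieve_closure_closed[OF sieve_pull, of c S f] pull_sieve_closure[of f c S]
  by (simp add: sieve_closure_id closed_sieve_def)

lemma closed_sieve_max: "closed_sieve C J c (max_sieve C c)"
  by (simp add: closed_sieve_def)

lemma closed_sieve_Int:
  assumes "closed_sieve C J c S" "closed_sieve C J c T"
  shows "closed_sieve C J c (S \<inter> T)"
proof -
  have sv: "sieve C c S" "sieve C c T" using assms by (auto simp: closed_sieve_def)
  have "f \<in> S \<inter> T" if "f \<in> max_sieve C c" "(Dom C f, pull C f (S \<inter> T)) \<in> J" for f
  proof -
    have "(Dom C f, pull C f S) \<in> J" "(Dom C f, pull C f T) \<in> J"
      using that sieve_pull sv by (auto elim!: cover_mono)
    then show ?thesis using that assms closed_sieveD by auto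
  qed
  moreover have "sieve C c (S \<inter> T)" using sv by (auto simp: sieve_def)
  ultimately show ?thesis by (auto simp: closed_sieve_def)
qed


section \<open>Closed sieves as truth values\<close>

text \<open>Negation is implication into the least element; apart from intersection and implication, each
  operation is a closure of an evident sieve, so closedness
  and stability under pullback need to be checked for closures and implications only.\<close>

lemma h_bot_eq: "c \<in> Obj C \<Longrightarrow> h_bot C J c = sieve_closure C J c {}"
  by (simp add: h_bot_def sieve_closure_def pull_def)

lemma h_or_eq: "h_or C J c S T = sieve_closure C J c (S \<union> T)"
  by (simp add: h_or_def sieve_closure_def)

lemma h_imp_iff:
  "f \<in> h_imp C c S T \<longleftrightarrow> f \<in> max_sieve C c \<and>
     (\<forall>g\<in>max_sieve C (Dom C f). Comp C f g \<in> S \<longrightarrow> Comp C f g \<in> T)"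
  by (auto simp: h_imp_def pull_def)

lemma h_neg_eq: "h_neg C J c S = h_imp C c S (h_bot C J c)"
  by (auto simp: h_imp_iff h_neg_def h_bot_def)

text \<open>If \<open>f\<close> is covered by arrows \<open>w\<close> with \<open>f w\<close> in \<open>S \<Rightarrow> T\<close> and \<open>f g \<in> S\<close>, then pulling that cover back
  along \<open>g\<close> shows that \<open>f g\<close> is locally in \<open>T\<close>, hence in \<open>T\<close>.\<close>

lemma closed_sieve_imp:
  assumes S: "closed_sieve C J c S" and T: "closed_sieve C J c T"
  shows "closed_sieve C J c (h_imp C c S T)"
proof -
  have sS: "sieve C c S" and sT: "sieve C c T" using assms by (auto simp: closed_sieve_def)
  have sv: "sieve C c (h_imp C c S T)"
    by (rule sieveI) (auto simp: h_imp_iff)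
  have "f \<in> h_imp C c S T"
    if f: "f \<in> max_sieve C c" and cov: "(Dom C f, pull C f (h_imp C c S T)) \<in> J" for f
    unfolding h_imp_iff
  proof (intro conjI ballI impI)
    fix g assume g: "g \<in> max_sieve C (Dom C f)" and fg: "Comp C f g \<in> S"
    have "(Dom C g, pull C g (pull C f (h_imp C c S T))) \<in> J"
      using cover_pull[OF cov g] .
    moreover have "pull C g (pull C f (h_imp C c S T)) \<subseteq> pull C (Comp C f g) T"
    proof
      fix w assume w: "w \<in> pull C g (pull C f (h_imp C c S T))"
      then have "Comp C (Comp C f g) w \<in> S" 
        using sieve_comp[OF sS fg, of w] f g by auto
      with w f g show "w \<in> pull C (Comp C f g) T"
        by (auto simp: h_imp_iff dest!: bspec[of _ _ "Id C (Dom C w)"])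
    qed
    ultimately have "(Dom C (Comp C f g), pull C (Comp C f g) T) \<in> J"
      using cover_mono sieve_pull[OF sT, of "Comp C f g"] f g by simp
    then show "Comp C f g \<in> T" using closed_sieveD[OF T] f g by simp
  qed (use f in simp)
  with sv show ?thesis by (simp add: closed_sieve_def)
qed

lemma sieve_empty: "sieve C c {}" by (simp add: sieve_def)

lemma interp_closed:
  assumes "c \<in> Obj C" "\<And>S. S \<in> set Ss \<Longrightarrow> closed_sieve C J c S" "vars \<phi> \<subseteq> {..<length Ss}"
  shows "closed_sieve C J c (interp C J c Ss \<phi>)"
  using assms(3)
proof (induction \<phi>)
  case (Or a b)
  then have "sieve C c (interp C J c Ss a \<union> interp C J c Ss b)"
    by (auto simp: closed_sieve_def sieve_def)
  then show ?case by (simp add: h_or_eq sieve_closure_closed)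
qed (simp_all add: assms(1,2) h_bot_eq h_neg_eq sieve_closure_closed sieve_empty closed_sieve_max
      closed_sieve_Int closed_sieve_imp)

lemma pull_h_imp:
  "f \<in> max_sieve C c \<Longrightarrow> pull C f (h_imp C c S T) = h_imp C (Dom C f) (pull C f S) (pull C f T)"
  by (auto simp: h_imp_iff)

text \<open>Naturality of \<open>f\<^sub>L\<close>. The bound on the variables matters: beyond the end of the list, indexing does
  not commute with \<open>map\<close>.\<close>

lemma pull_interp:
  assumes "f \<in> max_sieve C c" "vars \<phi> \<subseteq> {..<length Ss}"
  shows "pull C f (interp C J c Ss \<phi>) = interp C J (Dom C f) (map (pull C f) Ss) \<phi>"
proof -
  have [simp]: "f \<in> Arr C" "Cod C f = c" "c \<in> Obj C" using assms(1) by auto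
  have Un: "pull C f (A \<union> B) = pull C f A \<union> pull C f B" for A B by auto
  have In: "pull C f (A \<inter> B) = pull C f A \<inter> pull C f B" for A B by auto
  have Em: "pull C f {} = {}" by auto
  show ?thesis using assms(2)
    by (induction \<phi>)
      (simp_all add: h_bot_eq h_neg_eq h_or_eq pull_h_imp[OF assms(1)]
        pull_sieve_closure[OF assms(1)] pull_max[OF assms(1)] Un In Em)
qed

end

section \<open>Local operators and topologies\<close>

text \<open>The topology of a local operator \<open>j\<close>. Since \<open>j\<close> acts on \<open>J\<close>-closed sieves only, a sieve is replaced
  by its \<open>J\<close>-closure first; density of the inclusion of a sieve in a representable, after
  sheafification, amounts to this condition.\<close>

definition dense_sieves ::
  "('o, 'a) cat \<Rightarrow> ('o \<times> 'a set) set \<Rightarrow> ('o \<Rightarrow> 'a set \<Rightarrow> 'a set) \<Rightarrow> ('o \<times> 'a set) set" where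
  "dense_sieves C J j =
     {(c, R). c \<in> Obj C \<and> sieve C c R \<and> j c (sieve_closure C J c R) = max_sieve C c}"

definition closure_operator ::
  "('o, 'a) cat \<Rightarrow> ('o \<times> 'a set) set \<Rightarrow> ('o \<times> 'a set) set \<Rightarrow> 'o \<Rightarrow> 'a set \<Rightarrow> 'a set" where
  "closure_operator C J K = (\<lambda>c\<in>Obj C. \<lambda>S\<in>pobj (Omega C J) c. sieve_closure C K c S)"

context site
begin

lemma Omega_iff [simp]: "S \<in> pobj (Omega C J) c \<longleftrightarrow> closed_sieve C J c S"
  by (simp add: Omega_def)

lemma local_operatorD:
  assumes "local_operator C J j" "c \<in> Obj C" "closed_sieve C J c S"
  shows local_operator_closed: "closed_sieve C J c (j c S)"
    and local_operator_max: "j c (max_sieve C c) = max_sieve C c"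
    and local_operator_idem: "j c (j c S) = j c S"
    and local_operator_Int: "closed_sieve C J c T \<Longrightarrow> j c (S \<inter> T) = j c S \<inter> j c T"
proof -
  have "j \<in> nat_trans C (Omega C J) (Omega C J)" using assms(1) by (simp add: local_operator_def)
  from nat_trans_in[OF this assms(2), of S] show "closed_sieve C J c (j c S)"
    using assms(3) by simp
qed (use assms in \<open>simp_all add: local_operator_def\<close>)

lemma local_operator_pull:
  assumes "local_operator C J j" "f \<in> max_sieve C c" "closed_sieve C J c S"
  shows "pull C f (j c S) = j (Dom C f) (pull C f S)"
proof -
  have "j \<in> nat_trans C (Omega C J) (Omega C J)" using assms(1) by (simp add: local_operator_def)
  from nat_trans_natural[OF this, of f S] show ?thesis
    using assms(2,3) by (simp add: Omega_def)
qed

lemma local_operator_mono: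
  assumes "local_operator C J j" "c \<in> Obj C" "closed_sieve C J c S" "closed_sieve C J c T" "S \<subseteq> T"
  shows "j c S \<subseteq> j c T"
  using local_operator_Int[OF assms(1-4)] assms(5) by (simp add: Int_absorb2 inf.absorb_iff1)

text \<open>An arrow \<open>f\<close> lies in \<open>j S\<close> iff \<open>pull C f (j S) = j (pull C f S)\<close> is maximal: a local operator is recovered from
  its dense sieves.\<close>

lemma local_operator_eq_dense:
  assumes j: "local_operator C J j" and c: "c \<in> Obj C" and S: "closed_sieve C J c S"
  shows "j c S = sieve_closure C (dense_sieves C J j) c S"
proof -
  have sv: "sieve C c S" "sieve C c (j c S)"
    using S local_operator_closed[OF j c S] by (auto simp: closed_sieve_def)
  have "f \<in> j c S \<longleftrightarrow> (Dom C f, pull C f S) \<in> dense_sieves C J j" if f: "f \<in> max_sieve C c" for f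
    using pull_eq_max_iff[OF sv(2) f] local_operator_pull[OF j f S]
      sieve_closure_id[OF closed_sieve_pull[OF S f]] sieve_pull[OF sv(1) f] f
    by (simp add: dense_sieves_def)
  then show ?thesis using sv(2) by (auto simp: sieve_closure_def dest: sieve_arr)
qed

text \<open>Stability is naturality of \<open>j\<close>. For transitivity: if all \<open>f \<in> R\<close> pull \<open>S\<close> back to a dense sieve, then
  \<open>R\<close> is contained in the \<open>j\<close>-closure of \<open>S\<close>, and \<open>j\<close> is monotone and idempotent.\<close>

lemma dense_sieves_topology:
  assumes j: "local_operator C J j"
  shows "grothendieck_topology C (dense_sieves C J j)"
  unfolding grothendieck_topology_def
proof (intro conjI)
  let ?K = "dense_sieves C J j"
  have pull_K: "(Dom C f, pull C f R) \<in> ?K \<longleftrightarrow> f \<in> j c (sieve_closure C J c R)"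
    if R: "sieve C c R" and f: "f \<in> max_sieve C c" for c R f
  proof -
    have cl: "closed_sieve C J c (sieve_closure C J c R)" using sieve_closure_closed[OF R] .
    have "sieve C c (j c (sieve_closure C J c R))"
      using local_operator_closed[OF j _ cl] f by (auto simp: closed_sieve_def)
    from pull_eq_max_iff[OF this f] show ?thesis
      using local_operator_pull[OF j f cl] pull_sieve_closure[OF f] sieve_pull[OF R f] f
      by (simp add: dense_sieves_def)
  qed
  show "\<forall>(c, R)\<in>?K. c \<in> Obj C \<and> sieve C c R" by (auto simp: dense_sieves_def)
  show "\<forall>c\<in>Obj C. (c, max_sieve C c) \<in> ?K"
    using local_operator_max[OF j _ closed_sieve_max]
    by (simp add: dense_sieves_def sieve_closure_id[OF closed_sieve_max])
  show "\<forall>(c, R)\<in>?K. \<forall>f\<in>max_sieve C c. (Dom C f, pull C f R) \<in> ?K"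
  proof clarify
    fix c R f assume R: "(c, R) \<in> ?K" and f: "f \<in> max_sieve C c"
    then show "(Dom C f, pull C f R) \<in> ?K"
      using pull_K[of c R f] by (auto simp: dense_sieves_def)
  qed
  show "\<forall>(c, R)\<in>?K. \<forall>S. sieve C c S \<longrightarrow> (\<forall>f\<in>R. (Dom C f, pull C f S) \<in> ?K) \<longrightarrow> (c, S) \<in> ?K"
  proof clarify
    fix c R S assume R: "(c, R) \<in> ?K" and S: "sieve C c S"
      and RS: "\<forall>f\<in>R. (Dom C f, pull C f S) \<in> ?K"
    from R have c: "c \<in> Obj C" and sR: "sieve C c R"
      and max: "j c (sieve_closure C J c R) = max_sieve C c" by (auto simp: dense_sieves_def)
    note clR = sieve_closure_closed[OF sR] and clS = sieve_closure_closed[OF S]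
    let ?jS = "j c (sieve_closure C J c S)"
    have cl: "closed_sieve C J c ?jS" by (rule local_operator_closed[OF j c clS])
    have "R \<subseteq> ?jS" using RS pull_K[OF S] sieve_arr[OF sR] by auto
    then have "sieve_closure C J c R \<subseteq> ?jS"
      using sieve_closure_mono[OF sR _ \<open>R \<subseteq> ?jS\<close>] cl sieve_closure_id[OF cl]
      by (simp add: closed_sieve_def)
    then have "max_sieve C c \<subseteq> ?jS"
      using local_operator_mono[OF j c clR cl] local_operator_idem[OF j c clS] max by simp
    then have "?jS = max_sieve C c" using cl by (auto simp: closed_sieve_def sieve_def)
    then show "(c, S) \<in> ?K" using c S by (simp add: dense_sieves_def)
  qed
qed

lemma subset_dense_sieves:
  assumes "local_operator C J j"
  shows "J \<subseteq> dense_sieves C J j"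
proof clarify
  fix c R assume R: "(c, R) \<in> J"
  note cs = cover_obj[OF R] cover_sieve[OF R]
  show "(c, R) \<in> dense_sieves C J j"
    using sieve_closure_eq_max_iff[OF cs(2,1)] R cs local_operator_max[OF assms cs(1) closed_sieve_max]
    by (simp add: dense_sieves_def)
qed

lemma closure_operator_local:
  assumes K: "grothendieck_topology C K" "J \<subseteq> K"
  shows "local_operator C J (closure_operator C J K)"
proof -
  interpret K: site C K by unfold_locales (rule K)
  have JK: "closed_sieve C J c S" if "closed_sieve C K c S" for c S
    using that K(2) by (auto simp: closed_sieve_def)
  have cl: "closed_sieve C K c (sieve_closure C K c S)" if "closed_sieve C J c S" for c S
    using that by (intro K.sieve_closure_closed) (simp add: closed_sieve_def)
  note cl' = JK[OF cl]
  have op: "closure_operator C J K c S = sieve_closure C K c S"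
    if "c \<in> Obj C" "closed_sieve C J c S" for c S
    using that by (simp add: closure_operator_def)
  have Int: "sieve_closure C K c (S \<inter> T) = sieve_closure C K c S \<inter> sieve_closure C K c T"
    if "closed_sieve C J c S" "closed_sieve C J c T" for c S T
  proof
    have sv: "sieve C c S" "sieve C c T" "sieve C c (S \<inter> T)"
      using that closed_sieve_Int[OF that] by (auto simp: closed_sieve_def)
    then show "sieve_closure C K c (S \<inter> T) \<subseteq> sieve_closure C K c S \<inter> sieve_closure C K c T"
      by (simp add: K.sieve_closure_mono)
    show "sieve_closure C K c S \<inter> sieve_closure C K c T \<subseteq> sieve_closure C K c (S \<inter> T)"
    proof
      fix f assume "f \<in> sieve_closure C K c S \<inter> sieve_closure C K c T"
      then have f: "f \<in> max_sieve C c" and S: "(Dom C f, pull C f S) \<in> K"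
        and T: "(Dom C f, pull C f T) \<in> K" by (auto simp: sieve_closure_def)
      have "pull C f (S \<inter> T) = pull C f S \<inter> pull C f T" by auto
      then have "(Dom C f, pull C f (S \<inter> T)) \<in> K" using K.cover_Int[OF S T] by simp
      with f show "f \<in> sieve_closure C K c (S \<inter> T)" by (simp add: sieve_closure_def)
    qed
  qed
  have nat: "closure_operator C J K \<in> nat_trans C (Omega C J) (Omega C J)"
    unfolding nat_trans_def
  proof (intro CollectI conjI ballI)
    show "closure_operator C J K \<in> (\<Pi>\<^sub>E c\<in>Obj C. pobj (Omega C J) c \<rightarrow>\<^sub>E pobj (Omega C J) c)"
      by (simp add: closure_operator_def cl')
    fix f S assume "f \<in> Arr C" "S \<in> pobj (Omega C J) (Cod C f)"
    then show "closure_operator C J K (Dom C f) (pmap (Omega C J) f S)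
        = pmap (Omega C J) f (closure_operator C J K (Cod C f) S)"
      using closed_sieve_pull[of "Cod C f" S f] K.pull_sieve_closure[of f "Cod C f" S]
      by (simp add: op Omega_def)
  qed
  show ?thesis
    unfolding local_operator_def
    by (simp add: nat op cl cl' closed_sieve_max closed_sieve_Int Int K.closed_sieve_max
        K.sieve_closure_id)
qed

lemma dense_sieves_closure_operator:
  assumes K: "grothendieck_topology C K" "J \<subseteq> K"
  shows "dense_sieves C J (closure_operator C J K) = K"
proof -
  interpret K: site C K by unfold_locales (rule K)
  have "sieve_closure C K c (sieve_closure C J c R) = max_sieve C c \<longleftrightarrow> (c, R) \<in> K"
    if c: "c \<in> Obj C" and R: "sieve C c R" for c R
  proof -
    note cl = sieve_closure_sieve[OF R]
    have "(c, sieve_closure C J c R) \<in> K \<longleftrightarrow> (c, R) \<in> K"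
    proof
      assume "(c, sieve_closure C J c R) \<in> K"
      then show "(c, R) \<in> K"
        by (rule K.cover_trans[OF _ R]) (use K(2) in \<open>auto simp: sieve_closure_def\<close>)
    next
      assume "(c, R) \<in> K"
      then show "(c, sieve_closure C J c R) \<in> K"
        by (rule K.cover_mono[OF _ cl sieve_closure_subset[OF R]])
    qed
    then show ?thesis using K.sieve_closure_eq_max_iff[OF cl c] by simp
  qed
  then have "(c, R) \<in> dense_sieves C J (closure_operator C J K) \<longleftrightarrow> (c, R) \<in> K" for c R
    using K.cover_obj[of c R] K.cover_sieve[of c R]
    by (auto simp: dense_sieves_def closure_operator_def sieve_closure_closed simp del: in_max_sieve)
  then show ?thesis by auto
qed

text \<open>With \<open>closure_operator_local\<close> and \<open>dense_sieves_closure_operator\<close> this makes local operators on \<open>J\<close>-sheaves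
  and topologies above \<open>J\<close> isomorphic as ordered sets, so that least local operators can be found as
  least topologies.\<close>

lemma local_operator_le_iff:
  assumes j: "local_operator C J j" and j': "local_operator C J j'"
  shows "local_operator_le C J j j' \<longleftrightarrow> dense_sieves C J j \<subseteq> dense_sieves C J j'"
proof
  assume le: "local_operator_le C J j j'"
  show "dense_sieves C J j \<subseteq> dense_sieves C J j'"
  proof clarify
    fix c R assume "(c, R) \<in> dense_sieves C J j"
    then have c: "c \<in> Obj C" and R: "sieve C c R"
      and max: "j c (sieve_closure C J c R) = max_sieve C c" by (auto simp: dense_sieves_def)
    note cl = sieve_closure_closed[OF R]
    have "max_sieve C c \<subseteq> j' c (sieve_closure C J c R)"
      using le c cl unfolding local_operator_le_def max[symmetric] by simp
    moreover have "j' c (sieve_closure C J c R) \<subseteq> max_sieve C c"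
      using local_operator_closed[OF j' c cl] by (simp add: closed_sieve_def sieve_def)
    ultimately have "j' c (sieve_closure C J c R) = max_sieve C c" by (rule equalityI[rotated])
    then show "(c, R) \<in> dense_sieves C J j'" using c R by (simp add: dense_sieves_def)
  qed
next
  assume "dense_sieves C J j \<subseteq> dense_sieves C J j'"
  then have "sieve_closure C (dense_sieves C J j) c S \<subseteq> sieve_closure C (dense_sieves C J j') c S"
    for c S by (auto simp: sieve_closure_def)
  then show "local_operator_le C J j j'"
    by (simp add: local_operator_le_def local_operator_eq_dense[OF j] local_operator_eq_dense[OF j'])
qed

lemma local_operator_eqI:
  assumes j: "local_operator C J j" and j': "local_operator C J j'"
    and eq: "dense_sieves C J j = dense_sieves C J j'"
  shows "j = j'"
proof -
  have "j \<in> nat_trans C (Omega C J) (Omega C J)" "j' \<in> nat_trans C (Omega C J) (Omega C J)"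
    using j j' by (simp_all add: local_operator_def)
  then show ?thesis
    by (rule nat_trans_eqI)
      (simp add: local_operator_eq_dense[OF j] local_operator_eq_dense[OF j'] eq)
qed

lemma dense_iff:
  "j_dense C j B A \<longleftrightarrow>
     (\<forall>c\<in>Obj C. \<forall>x\<in>pobj B c. j c {f \<in> max_sieve C c. pmap B f x \<in> A (Dom C f)} = max_sieve C c)"
  by (auto simp: j_dense_def j_closure_def nat_comp_def char_map_def)

lemma pobj_power_Omega:
  "Ss \<in> pobj (power_psh n (Omega C J)) c \<longleftrightarrow> length Ss = n \<and> (\<forall>S\<in>set Ss. closed_sieve C J c S)"
  by (auto simp: power_psh_def)

text \<open>The heart of the matter. A tuple pulled back along \<open>f\<close> lies in the equalizer iff \<open>f\<^sub>L\<close> of it is maximal,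
  which by naturality says that \<open>f\<close> belongs to \<open>f\<^sub>L\<close> of the original tuple. So the sieves
  \<open>f\<^sub>L(S\<^sub>1, \<dots>, S\<^sub>n)\<close> are exactly the values of the classifying map of the equalizer, and
  density of the equalizer says that these sieves are dense.\<close>

lemma equalizer_dense_iff:
  assumes j: "local_operator C J j" and \<phi>: "vars \<phi> \<subseteq> {..<n}"
  shows "equalizer_dense C J n \<phi> j \<longleftrightarrow>
    {(c, f_map C J n \<phi> c Ss) | c Ss.
       c \<in> Obj C \<and> length Ss = n \<and> (\<forall>S\<in>set Ss. closed_sieve C J c S)} \<subseteq> dense_sieves C J j"
proof -
  let ?P = "power_psh n (Omega C J)"
  have char: "{f \<in> max_sieve C c. pmap ?P f Ss \<in> equalizer ?P (f_map C J n \<phi>) (g_map C J n) (Dom C f)}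
      = f_map C J n \<phi> c Ss"
    and dense: "j c (f_map C J n \<phi> c Ss) = max_sieve C c \<longleftrightarrow> (c, f_map C J n \<phi> c Ss) \<in> dense_sieves C J j"
    if c: "c \<in> Obj C" and Ss: "Ss \<in> pobj ?P c" for c Ss
  proof -
    have f: "f_map C J n \<phi> c Ss = interp C J c Ss \<phi>"
      using c Ss by (simp add: f_map_def)
    have cl: "closed_sieve C J c (interp C J c Ss \<phi>)"
      using c Ss \<phi> by (intro interp_closed) (auto simp: pobj_power_Omega)
    have "pmap ?P f Ss \<in> equalizer ?P (f_map C J n \<phi>) (g_map C J n) (Dom C f)
        \<longleftrightarrow> f \<in> interp C J c Ss \<phi>" if fm: "f \<in> max_sieve C c" for f
    proof -
      have P: "map (pull C f) Ss \<in> pobj ?P (Dom C f)"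
        using Ss closed_sieve_pull[OF _ fm] by (auto simp: pobj_power_Omega)
      have "f_map C J n \<phi> (Dom C f) (map (pull C f) Ss) = pull C f (interp C J c Ss \<phi>)"
        using P fm pull_interp[OF fm, of \<phi> Ss] \<phi> Ss by (simp add: f_map_def pobj_power_Omega)
      moreover have "g_map C J n (Dom C f) (map (pull C f) Ss) = max_sieve C (Dom C f)"
        using P fm by (simp add: g_map_def Let_def nat_comp_def truth_def)
      ultimately show ?thesis
        using P pull_eq_max_iff[OF _ fm] cl
        by (simp add: equalizer_def power_psh_def Omega_def closed_sieve_def)
    qed
    then show "{f \<in> max_sieve C c. pmap ?P f Ss \<in> equalizer ?P (f_map C J n \<phi>) (g_map C J n) (Dom C f)}
      = f_map C J n \<phi> c Ss"
      using cl f by (auto simp: closed_sieve_def dest: sieve_arr)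
    show "j c (f_map C J n \<phi> c Ss) = max_sieve C c \<longleftrightarrow> (c, f_map C J n \<phi> c Ss) \<in> dense_sieves C J j"
      using cl c f by (simp add: dense_sieves_def sieve_closure_id closed_sieve_def)
  qed
  show ?thesis
    unfolding equalizer_dense_def Let_def dense_iff
    by (simp add: char dense del: in_max_sieve cong: ball_cong) (use pobj_power_Omega in blast)
qed

end

text \<open>The family of all topologies containing \<open>J\<close> and \<open>G\<close> has to be nonempty, for which the topology of all
  sieves serves; this is where \<open>G\<close> must consist of sieves.\<close>

lemma generated_topology_topology:
  assumes "category C" "\<And>c R. (c, R) \<in> J \<union> G \<Longrightarrow> c \<in> Obj C \<and> sieve C c R"
  shows "grothendieck_topology C (generated_topology C J G)"
proof -
  interpret category C by fact
  let ?\<K> = "{K. grothendieck_topology C K \<and> J \<subseteq> K \<and> G \<subseteq> K}"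
  have "grothendieck_topology C {(c, R). c \<in> Obj C \<and> sieve C c R}"
    by (auto simp: grothendieck_topology_def intro!: sieve_pull)
  then have "{(c, R). c \<in> Obj C \<and> sieve C c R} \<in> ?\<K>" using assms(2) by auto
  then have "\<forall>(c, R)\<in>\<Inter>?\<K>. c \<in> Obj C \<and> sieve C c R" by blast
  moreover have "\<forall>c\<in>Obj C. (c, max_sieve C c) \<in> \<Inter>?\<K>"
    by (auto simp: grothendieck_topology_def simp del: in_max_sieve)
  moreover have "(Dom C f, pull C f R) \<in> \<Inter>?\<K>"
    if "(c, R) \<in> \<Inter>?\<K>" "f \<in> max_sieve C c" for c R f
  proof (rule InterI)
    fix K assume K: "K \<in> ?\<K>"
    then interpret site C K by unfold_locales simp
    show "(Dom C f, pull C f R) \<in> K" using cover_pull[of c R f] that K by blast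
  qed
  moreover have "(c, S) \<in> \<Inter>?\<K>"
    if "(c, R) \<in> \<Inter>?\<K>" "sieve C c S" "\<forall>f\<in>R. (Dom C f, pull C f S) \<in> \<Inter>?\<K>" for c R S
  proof (rule InterI)
    fix K assume K: "K \<in> ?\<K>"
    then interpret site C K by unfold_locales simp
    show "(c, S) \<in> K" using cover_trans[of c R S] that K by blast
  qed
  ultimately show ?thesis
    unfolding generated_topology_def
    by (subst grothendieck_topology_def) (intro conjI; blast)
qed

section \<open>Sheaves and subsheaves\<close>

context category
begin

lemma
  assumes "presheaf C F"
  shows psh_in: "f \<in> Arr C \<Longrightarrow> x \<in> pobj F (Cod C f) \<Longrightarrow> pmap F f x \<in> pobj F (Dom C f)"
    and psh_id: "c \<in> Obj C \<Longrightarrow> x \<in> pobj F c \<Longrightarrow> pmap F (Id C c) x = x"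
    and psh_comp: "f \<in> Arr C \<Longrightarrow> g \<in> Arr C \<Longrightarrow> Cod C g = Dom C f \<Longrightarrow> x \<in> pobj F (Cod C f) \<Longrightarrow>
      pmap F (Comp C f g) x = pmap F g (pmap F f x)"
  using assms by (auto simp: presheaf_def)

lemma presheafI:
  assumes "\<And>f x. f \<in> Arr C \<Longrightarrow> x \<in> pobj F (Cod C f) \<Longrightarrow> pmap F f x \<in> pobj F (Dom C f)"
    and "\<And>c x. c \<in> Obj C \<Longrightarrow> x \<in> pobj F c \<Longrightarrow> pmap F (Id C c) x = x"
    and "\<And>f g x. f \<in> Arr C \<Longrightarrow> g \<in> Arr C \<Longrightarrow> Cod C g = Dom C f \<Longrightarrow> x \<in> pobj F (Cod C f) \<Longrightarrow>
      pmap F (Comp C f g) x = pmap F g (pmap F f x)"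
  shows "presheaf C F"
  using assms by (simp add: presheaf_def)

lemma matching_family_in: "matching_family C F R x \<Longrightarrow> f \<in> R \<Longrightarrow> x f \<in> pobj F (Dom C f)"
  and matching_family_map: "matching_family C F R x \<Longrightarrow> f \<in> R \<Longrightarrow> g \<in> Arr C \<Longrightarrow>
    Cod C g = Dom C f \<Longrightarrow> pmap F g (x f) = x (Comp C f g)"
  by (auto simp: matching_family_def)

lemma matching_family_element:
  assumes "presheaf C F" "sieve C c R" "y \<in> pobj F c"
  shows "matching_family C F R (\<lambda>f. pmap F f y)"
  using assms psh_in[OF assms(1)] psh_comp[OF assms(1)]
  by (auto simp: matching_family_def dest: sieve_arr)

lemma Sh_presheaf: "F \<in> Sh C J \<Longrightarrow> presheaf C F"
  by (simp add: Sh_def)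

lemma Sh_glue:
  assumes "F \<in> Sh C J" "(c, R) \<in> J" "matching_family C F R x"
  obtains y where "y \<in> pobj F c" "\<And>f. f \<in> R \<Longrightarrow> pmap F f y = x f"
  using assms unfolding Sh_def by blast

end

context site
begin

lemma Sh_eqI:
  assumes "F \<in> Sh C J" "(c, R) \<in> J" "y \<in> pobj F c" "y' \<in> pobj F c"
    and "\<And>f. f \<in> R \<Longrightarrow> pmap F f y = pmap F f y'"
  shows "y = y'"
proof -
  have "matching_family C F R (\<lambda>f. pmap F f y')"
    using matching_family_element[OF Sh_presheaf[OF assms(1)] cover_sieve[OF assms(2)] assms(4)] .
  then have "\<exists>!z. z \<in> pobj F c \<and> (\<forall>f\<in>R. pmap F f z = pmap F f y')"
    using assms(1,2) unfolding Sh_def by blast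
  then show ?thesis using assms(3-5) by blast
qed

lemma ShI:
  assumes "presheaf C F"
    and sep: "\<And>c R y y'. (c, R) \<in> J \<Longrightarrow> y \<in> pobj F c \<Longrightarrow> y' \<in> pobj F c \<Longrightarrow>
      (\<And>f. f \<in> R \<Longrightarrow> pmap F f y = pmap F f y') \<Longrightarrow> y = y'"
    and glue: "\<And>c R x. (c, R) \<in> J \<Longrightarrow> matching_family C F R x \<Longrightarrow>
      \<exists>y\<in>pobj F c. \<forall>f\<in>R. pmap F f y = x f"
  shows "F \<in> Sh C J"
proof -
  have "\<exists>!y. y \<in> pobj F c \<and> (\<forall>f\<in>R. pmap F f y = x f)"
    if "(c, R) \<in> J" "matching_family C F R x" for c R x
    using glue[OF that] sep[OF that(1)] by metis
  then show ?thesis using assms(1) unfolding Sh_def by blast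
qed

lemma Sh_antimono:
  assumes K: "J \<subseteq> K" and F: "F \<in> Sh C K"
  shows "F \<in> Sh C J"
proof -
  have "\<exists>!y. y \<in> pobj F c \<and> (\<forall>f\<in>R. pmap F f y = x f)"
    if "(c, R) \<in> J" "matching_family C F R x" for c R x
  proof -
    have "(c, R) \<in> K" using that(1) K by blast
    then show ?thesis using F that(2) unfolding Sh_def by blast
  qed
  then show ?thesis using Sh_presheaf[OF F] unfolding Sh_def by blast
qed

lemma subsheafI:
  assumes B: "B \<in> Sh C J" and sub: "\<And>c. c \<in> Obj C \<Longrightarrow> A c \<subseteq> pobj B c"
    and stable: "\<And>f x. f \<in> Arr C \<Longrightarrow> x \<in> A (Cod C f) \<Longrightarrow> pmap B f x \<in> A (Dom C f)"
    and loc: "\<And>c R x. (c, R) \<in> J \<Longrightarrow> x \<in> pobj B c \<Longrightarrow>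
      (\<And>f. f \<in> R \<Longrightarrow> pmap B f x \<in> A (Dom C f)) \<Longrightarrow> x \<in> A c"
  shows "subsheaf C J B A"
  unfolding subsheaf_def
proof (intro conjI ballI)
  note psh = Sh_presheaf[OF B]
  have sub': "x \<in> pobj B c" if "x \<in> A c" "c \<in> Obj C" for c x using sub that by blast
  show "B\<lparr>pobj := A\<rparr> \<in> Sh C J"
  proof (rule ShI)
    show "presheaf C (B\<lparr>pobj := A\<rparr>)"
      by (rule presheafI) (use stable sub' psh_id[OF psh] psh_comp[OF psh] in auto)
  next
    fix c R y y' assume cR: "(c, R) \<in> J" and y: "y \<in> pobj (B\<lparr>pobj := A\<rparr>) c" "y' \<in> pobj (B\<lparr>pobj := A\<rparr>) c"
      and eq: "\<And>f. f \<in> R \<Longrightarrow> pmap (B\<lparr>pobj := A\<rparr>) f y = pmap (B\<lparr>pobj := A\<rparr>) f y'"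
    then show "y = y'" using Sh_eqI[OF B cR] sub' cover_obj[OF cR] by simp
  next
    fix c R x assume cR: "(c, R) \<in> J" and x: "matching_family C (B\<lparr>pobj := A\<rparr>) R x"
    have "matching_family C B R x"
      using x sub' sieve_arr[OF cover_sieve[OF cR]] by (auto simp: matching_family_def)
    then obtain y where y: "y \<in> pobj B c" "\<And>f. f \<in> R \<Longrightarrow> pmap B f y = x f"
      by (rule Sh_glue[OF B cR]) blast
    have "y \<in> A c" using loc[OF cR y(1)] matching_family_in[OF x] y(2) by simp
    with y(2) show "\<exists>y\<in>pobj (B\<lparr>pobj := A\<rparr>) c. \<forall>f\<in>R. pmap (B\<lparr>pobj := A\<rparr>) f y = x f" by auto
  qed
qed (use sub in blast)

lemma subsheaf_subset: "subsheaf C J B A \<Longrightarrow> c \<in> Obj C \<Longrightarrow> x \<in> A c \<Longrightarrow> x \<in> pobj B c"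
  by (auto simp: subsheaf_def)

lemma subsheaf_stable:
  "subsheaf C J B A \<Longrightarrow> f \<in> Arr C \<Longrightarrow> x \<in> A (Cod C f) \<Longrightarrow> pmap B f x \<in> A (Dom C f)"
  using psh_in[OF Sh_presheaf, of "B\<lparr>pobj := A\<rparr>"] by (auto simp: subsheaf_def)

lemma subsheaf_local:
  assumes B: "B \<in> Sh C J" and A: "subsheaf C J B A" and cR: "(c, R) \<in> J" and x: "x \<in> pobj B c"
    and loc: "\<And>f. f \<in> R \<Longrightarrow> pmap B f x \<in> A (Dom C f)"
  shows "x \<in> A c"
proof -
  have BA: "B\<lparr>pobj := A\<rparr> \<in> Sh C J" using A by (simp add: subsheaf_def)
  have "matching_family C (B\<lparr>pobj := A\<rparr>) R (\<lambda>f. pmap B f x)"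
    using matching_family_element[OF Sh_presheaf[OF B] cover_sieve[OF cR] x] loc
    by (simp add: matching_family_def)
  from Sh_glue[OF BA cR this] obtain y where y: "y \<in> A c" "\<And>f. f \<in> R \<Longrightarrow> pmap B f y = pmap B f x"
    by auto
  have "y = x" using Sh_eqI[OF B cR _ x y(2)] subsheaf_subset[OF A cover_obj[OF cR] y(1)] .
  with y(1) show ?thesis by simp
qed

text \<open>The value of the classifying map of \<open>A\<close> at \<open>x\<close>. It is closed since membership in a subsheaf is local.\<close>

lemma closed_sieve_char:
  assumes B: "B \<in> Sh C J" and A: "subsheaf C J B A" and x: "x \<in> pobj B c"
  shows "closed_sieve C J c {f \<in> max_sieve C c. pmap B f x \<in> A (Dom C f)}"
  (is "closed_sieve C J c ?X")
  unfolding closed_sieve_def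
proof (intro conjI ballI impI)
  note psh = Sh_presheaf[OF B]
  show "sieve C c ?X"
    by (rule sieveI) (use x psh_comp[OF psh] subsheaf_stable[OF A] in auto)
  fix f assume f: "f \<in> max_sieve C c" and cov: "(Dom C f, pull C f ?X) \<in> J"
  have "pmap B f x \<in> A (Dom C f)"
    by (rule subsheaf_local[OF B A cov]) (use f x psh_in[OF psh] psh_comp[OF psh] in auto)
  with f show "f \<in> ?X" by simp
qed

section \<open>Sheaves for the dense sieves are sheaves for the local operator\<close>

text \<open>Let \<open>A\<close> be dense in \<open>B\<close>. Each \<open>x \<in> B c\<close> restricts into \<open>A\<close> along a dense sieve, and the values of \<open>h\<close>
  at these restrictions form a matching family, whose amalgamation is the only possible value of an
  extension of \<open>h\<close> at \<open>x\<close>.\<close>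

lemma Sh_dense_sieves_subset:
  assumes j: "local_operator C J j"
  shows "Sh C (dense_sieves C J j) \<subseteq> sh_sub C J j"
proof
  let ?K = "dense_sieves C J j"
  interpret K: site C ?K by unfold_locales (rule dense_sieves_topology[OF j])
  fix F assume F: "F \<in> Sh C ?K"
  then have FJ: "F \<in> Sh C J" by (rule Sh_antimono[OF subset_dense_sieves[OF j]])
  note pshF = Sh_presheaf[OF F]
  have "\<exists>!k. k \<in> nat_trans C B F \<and> (\<forall>c\<in>Obj C. \<forall>x\<in>A c. k c x = h c x)"
    if B: "B \<in> Sh C J" and A: "subsheaf C J B A" and dense: "j_dense C j B A"
      and h: "h \<in> nat_trans C (B\<lparr>pobj := A\<rparr>) F" for B A h
  proof -
    note pshB = Sh_presheaf[OF B]
    let ?X = "\<lambda>c x. {f \<in> max_sieve C c. pmap B f x \<in> A (Dom C f)}"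
    have cov: "(c, ?X c x) \<in> ?K" if "c \<in> Obj C" "x \<in> pobj B c" for c x
      using closed_sieve_char[OF B A that(2)] dense that
      by (simp add: dense_sieves_def sieve_closure_id closed_sieve_def dense_iff del: in_max_sieve)
    have h_in: "h c x \<in> pobj F c" if "c \<in> Obj C" "x \<in> A c" for c x
      using nat_trans_in[OF h that(1)] that(2) by simp
    have h_nat: "h (Dom C f) (pmap B f x) = pmap F f (h (Cod C f) x)"
      if "f \<in> Arr C" "x \<in> A (Cod C f)" for f x
      using nat_trans_natural[OF h that(1)] that(2) by simp
    have ex: "\<exists>y. y \<in> pobj F c \<and> (\<forall>f\<in>?X c x. pmap F f y = h (Dom C f) (pmap B f x))"
      if c: "c \<in> Obj C" and x: "x \<in> pobj B c" for c x
    proof -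
      have "matching_family C F (?X c x) (\<lambda>f. h (Dom C f) (pmap B f x))"
        unfolding matching_family_def
      proof (intro conjI ballI)
        fix f g assume f: "f \<in> ?X c x" and g: "g \<in> max_sieve C (Dom C f)"
        then show "pmap F g (h (Dom C f) (pmap B f x)) = h (Dom C (Comp C f g)) (pmap B (Comp C f g) x)"
          using h_nat[of g "pmap B f x"] x psh_comp[OF pshB, of f g x] by simp
      qed (use h_in in simp)
      then show ?thesis by (rule Sh_glue[OF F cov[OF c x]]) blast
    qed
    define k where "k c x = (SOME y. y \<in> pobj F c \<and> (\<forall>f\<in>?X c x. pmap F f y = h (Dom C f) (pmap B f x)))"
      for c x
    have k: "k c x \<in> pobj F c" "\<And>f. f \<in> ?X c x \<Longrightarrow> pmap F f (k c x) = h (Dom C f) (pmap B f x)"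
      if "c \<in> Obj C" "x \<in> pobj B c" for c x
      using someI_ex[OF ex[OF that]] by (simp_all add: k_def)
    have unique: "y = k c x" if c: "c \<in> Obj C" and x: "x \<in> pobj B c" and y: "y \<in> pobj F c"
      "\<And>f. f \<in> ?X c x \<Longrightarrow> pmap F f y = h (Dom C f) (pmap B f x)" for c x y
      by (rule K.Sh_eqI[OF F cov[OF c x] y(1) k(1)[OF c x]]) (simp only: y(2) k(2)[OF c x])
    let ?k = "\<lambda>c\<in>Obj C. \<lambda>x\<in>pobj B c. k c x"
    have "?k \<in> nat_trans C B F"
    proof (rule nat_transI)
      fix f x assume f: "f \<in> Arr C" and x: "x \<in> pobj B (Cod C f)"
      show "k (Dom C f) (pmap B f x) = pmap F f (k (Cod C f) x)"
      proof (rule unique[symmetric])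
        fix g assume g: "g \<in> ?X (Dom C f) (pmap B f x)"
        then have fg: "Comp C f g \<in> ?X (Cod C f) x" using f x psh_comp[OF pshB] by simp
        have "pmap F g (pmap F f (k (Cod C f) x)) = pmap F (Comp C f g) (k (Cod C f) x)"
          using psh_comp[OF pshF f] k(1)[OF _ x] f g by simp
        also have "\<dots> = h (Dom C g) (pmap B g (pmap B f x))"
          using k(2)[OF _ x fg] psh_comp[OF pshB f _ _ x, of g] f g by simp
        finally show "pmap F g (pmap F f (k (Cod C f) x)) = h (Dom C g) (pmap B g (pmap B f x))" .
      qed (use f x psh_in[OF pshB] psh_in[OF pshF] k(1) in simp_all)
    qed (use k(1) psh_in[OF pshB] in simp_all)
    moreover have "\<forall>c\<in>Obj C. \<forall>x\<in>A c. ?k c x = h c x"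
    proof (intro ballI)
      fix c x assume c: "c \<in> Obj C" and x: "x \<in> A c"
      have "h c x = k c x"
        by (rule unique[OF c subsheaf_subset[OF A c x] h_in[OF c x]]) (use x h_nat in auto)
      then show "?k c x = h c x" using c subsheaf_subset[OF A c x] by simp
    qed
    ultimately have extends: "?k \<in> nat_trans C B F \<and> (\<forall>c\<in>Obj C. \<forall>x\<in>A c. ?k c x = h c x)" ..
    have "k' = ?k" if "k' \<in> nat_trans C B F \<and> (\<forall>c\<in>Obj C. \<forall>x\<in>A c. k' c x = h c x)" for k'
    proof (rule nat_trans_eqI[OF _ conjunct1[OF extends]])
      from that show k': "k' \<in> nat_trans C B F" ..
      from that have ext: "\<forall>c\<in>Obj C. \<forall>x\<in>A c. k' c x = h c x" ..
      fix c x assume c: "c \<in> Obj C" and x: "x \<in> pobj B c"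
      have "k' c x = k c x"
      proof (rule unique[OF c x nat_trans_in[OF k' c x]])
        fix f assume f: "f \<in> ?X c x"
        then show "pmap F f (k' c x) = h (Dom C f) (pmap B f x)"
          using nat_trans_natural[OF k', of f x] ext x by auto
      qed
      then show "k' c x = ?k c x" using c x by simp
    qed
    with extends show ?thesis by (rule ex1I)
  qed
  note extension = this
  show "F \<in> sh_sub C J j"
    unfolding sh_sub_def
    by (intro CollectI conjI allI impI ballI FJ, elim conjE) (rule extension)
qed

end

section \<open>Renaming the elements of a presheaf\<close>

text \<open>Sheaves with values in a fixed type of elements are tested below against sheaves whose elements are
  relations between arrows; these are first coded along an injection \<open>\<iota>\<close>.\<close>

definition psh_image :: "('v \<Rightarrow> 'w) \<Rightarrow> ('o, 'a, 'v) psh \<Rightarrow> ('o, 'a, 'w) psh" where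
  "psh_image \<iota> F = \<lparr>pobj = (\<lambda>c. \<iota> ` pobj F c), pmap = (\<lambda>f v. \<iota> (pmap F f (inv \<iota> v)))\<rparr>"

context site
begin

lemma psh_image_simps [simp]:
  "pobj (psh_image \<iota> F) c = \<iota> ` pobj F c"
  "inj \<iota> \<Longrightarrow> pmap (psh_image \<iota> F) f (\<iota> x) = \<iota> (pmap F f x)"
  by (simp_all add: psh_image_def)

lemma psh_image_Sh:
  assumes \<iota>: "inj \<iota>" and F: "F \<in> Sh C J"
  shows "psh_image \<iota> F \<in> Sh C J"
proof (rule ShI)
  note psh = Sh_presheaf[OF F]
  show "presheaf C (psh_image \<iota> F)"
    by (rule presheafI) (use \<iota> psh_in[OF psh] psh_id[OF psh] psh_comp[OF psh] in auto)
next
  fix c R y y' assume cR: "(c, R) \<in> J"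
    and y: "y \<in> pobj (psh_image \<iota> F) c" "y' \<in> pobj (psh_image \<iota> F) c"
    and eq: "\<And>f. f \<in> R \<Longrightarrow> pmap (psh_image \<iota> F) f y = pmap (psh_image \<iota> F) f y'"
  from y obtain z z' where z: "y = \<iota> z" "y' = \<iota> z'" "z \<in> pobj F c" "z' \<in> pobj F c" by auto
  have "z = z'"
    by (rule Sh_eqI[OF F cR z(3,4)]) (use eq \<iota> in \<open>auto simp: z inj_eq\<close>)
  then show "y = y'" by (simp add: z)
next
  fix c R x assume cR: "(c, R) \<in> J" and x: "matching_family C (psh_image \<iota> F) R x"
  define z where "z f = inv \<iota> (x f)" for f
  have z: "x f = \<iota> (z f)" "z f \<in> pobj F (Dom C f)" if "f \<in> R" for f
    using matching_family_in[OF x that] \<iota> by (auto simp: z_def)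
  have "matching_family C F R z"
    unfolding matching_family_def
  proof (intro conjI ballI)
    fix f g assume f: "f \<in> R" and g: "g \<in> max_sieve C (Dom C f)"
    then have "Comp C f g \<in> R" using cover_sieve[OF cR] by (auto simp: sieve_def)
    then show "pmap F g (z f) = z (Comp C f g)"
      using matching_family_map[OF x f, of g] g z f \<iota> by (simp add: inj_eq)
  qed (use z in blast)
  from Sh_glue[OF F cR this] obtain y where "y \<in> pobj F c" "\<And>f. f \<in> R \<Longrightarrow> pmap F f y = z f" by blast
  then show "\<exists>y\<in>pobj (psh_image \<iota> F) c. \<forall>f\<in>R. pmap (psh_image \<iota> F) f y = x f"
    using z \<iota> by (intro bexI[of _ "\<iota> y"]) simp_all
qed

lemma sh_subD:
  fixes F B :: "('o, 'a, 'v) psh"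
  assumes "F \<in> sh_sub C J j" "B \<in> Sh C J" "subsheaf C J B A" "j_dense C j B A"
    "h \<in> nat_trans C (B\<lparr>pobj := A\<rparr>) F"
  shows "\<exists>!k. k \<in> nat_trans C B F \<and> (\<forall>c\<in>Obj C. \<forall>x\<in>A c. k c x = h c x)"
proof -
  have "\<forall>(B :: ('o, 'a, 'v) psh) A. B \<in> Sh C J \<and> subsheaf C J B A \<and> j_dense C j B A \<longrightarrow>
     (\<forall>h\<in>nat_trans C (B\<lparr>pobj := A\<rparr>) F.
        \<exists>!k. k \<in> nat_trans C B F \<and> (\<forall>c\<in>Obj C. \<forall>x\<in>A c. k c x = h c x))"
    using assms(1) by (simp add: sh_sub_def)
  from this[rule_format, OF conjI[OF assms(2) conjI[OF assms(3,4)]] assms(5)] show ?thesis .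
qed

text \<open>In \<open>sh_sub\<close> the test sheaves have the same type of elements as the \<open>j\<close>-sheaf; coding by \<open>\<iota>\<close> makes the
  extension property available for every smaller type.\<close>

lemma sh_sub_extend:
  fixes F :: "('o, 'a, 'v) psh" and B :: "('o, 'a, 'w) psh" and \<iota> :: "'w \<Rightarrow> 'v"
  assumes F: "F \<in> sh_sub C J j" and \<iota>: "inj \<iota>"
    and B: "B \<in> Sh C J" and A: "subsheaf C J B A" and dense: "j_dense C j B A"
    and h: "h \<in> nat_trans C (B\<lparr>pobj := A\<rparr>) F"
  shows "\<exists>!k. k \<in> nat_trans C B F \<and> (\<forall>c\<in>Obj C. \<forall>x\<in>A c. k c x = h c x)"
proof -
  let ?B = "psh_image \<iota> B" and ?A = "\<lambda>c. \<iota> ` A c"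
  have img: "?B\<lparr>pobj := ?A\<rparr> = psh_image \<iota> (B\<lparr>pobj := A\<rparr>)" by (simp add: psh_image_def)
  have B': "?B \<in> Sh C J" by (rule psh_image_Sh[OF \<iota> B])
  have A': "subsheaf C J ?B ?A"
    using A psh_image_Sh[OF \<iota>, of "B\<lparr>pobj := A\<rparr>"] unfolding subsheaf_def img
    by (simp add: image_mono)
  have dense': "j_dense C j ?B ?A"
    using dense \<iota> by (simp add: dense_iff inj_image_mem_iff)
  have transport: "(\<lambda>c\<in>Obj C. \<lambda>v\<in>pobj (psh_image \<iota> G) c. k c (inv \<iota> v)) \<in> nat_trans C (psh_image \<iota> G) F"
    if k: "k \<in> nat_trans C G F" and G: "presheaf C G" for G :: "('o, 'a, 'w) psh" and k
    by (rule nat_transI) (use \<iota> psh_in[OF G] nat_trans_in[OF k] nat_trans_natural[OF k] in auto)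
  note pshB = Sh_presheaf[OF B]
  have pshA: "presheaf C (B\<lparr>pobj := A\<rparr>)" using A Sh_presheaf by (auto simp: subsheaf_def)
  let ?ext = "\<lambda>k'. k' \<in> nat_trans C ?B F \<and> (\<forall>c\<in>Obj C. \<forall>x\<in>A c. k' c (\<iota> x) = h c x)"
  have ex1: "\<exists>!k'. ?ext k'"
  proof -
    let ?h = "\<lambda>c\<in>Obj C. \<lambda>v\<in>?A c. h c (inv \<iota> v)"
    have "?h \<in> nat_trans C (?B\<lparr>pobj := ?A\<rparr>) F" using transport[OF h pshA] unfolding img by simp
    from sh_subD[OF F B' A' dense' this]
    have "\<exists>!k'. k' \<in> nat_trans C ?B F \<and> (\<forall>c\<in>Obj C. \<forall>v\<in>?A c. k' c v = ?h c v)" .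
    moreover have "(\<forall>c\<in>Obj C. \<forall>v\<in>?A c. k' c v = ?h c v) \<longleftrightarrow>
      (\<forall>c\<in>Obj C. \<forall>x\<in>A c. k' c (\<iota> x) = h c x)" for k'
      using \<iota> by simp
    ultimately show ?thesis by (simp only:)
  qed
  then obtain k' where k': "?ext k'" by (elim ex1E)
  show ?thesis
  proof (rule ex1I)
    let ?k = "\<lambda>c\<in>Obj C. \<lambda>x\<in>pobj B c. k' c (\<iota> x)"
    have "?k \<in> nat_trans C B F"
    proof (rule nat_transI)
      fix f x assume "f \<in> Arr C" "x \<in> pobj B (Cod C f)"
      then show "k' (Dom C f) (\<iota> (pmap B f x)) = pmap F f (k' (Cod C f) (\<iota> x))"
        using nat_trans_natural[of k' ?B F f "\<iota> x"] k' \<iota> by simp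
    qed (use k' psh_in[OF pshB] nat_trans_in[of k' ?B F] in auto)
    moreover have "\<forall>c\<in>Obj C. \<forall>x\<in>A c. ?k c x = h c x"
      using k' subsheaf_subset[OF A] by simp
    ultimately show ext: "?k \<in> nat_trans C B F \<and> (\<forall>c\<in>Obj C. \<forall>x\<in>A c. ?k c x = h c x)" ..
    fix k assume k: "k \<in> nat_trans C B F \<and> (\<forall>c\<in>Obj C. \<forall>x\<in>A c. k c x = h c x)"
    let ?k' = "\<lambda>c\<in>Obj C. \<lambda>v\<in>pobj ?B c. k c (inv \<iota> v)"
    have "?ext ?k'" using transport[OF _ pshB] k subsheaf_subset[OF A] \<iota> by simp
    then have "?k' = k'" using the1_equality[OF ex1, of k'] the1_equality[OF ex1, of ?k'] k' by simp
    then have "k' c (\<iota> x) = ?k' c (\<iota> x)" for c x by (simp only:)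
    then have eq: "k' c (\<iota> x) = k c x" if "c \<in> Obj C" "x \<in> pobj B c" for c x
      using that \<iota> by simp
    show "k = ?k"
      by (rule nat_trans_eqI[OF conjunct1[OF k] conjunct1[OF ext]]) (simp add: eq)
  qed
qed

end

section \<open>Power objects\<close>

text \<open>The power object \<open>\<Omega>\<^bsup>X\<^esup>\<close>: its elements at \<open>d\<close> are the \<open>J\<close>-closed subpresheaves of the product of the
  representable of \<open>d\<close> with \<open>X\<close>. One construction serves two purposes: for \<open>X\<close> terminal it is the subobject
  classifier, and for \<open>X\<close> representable it contains the sheafification of \<open>X\<close>.\<close>

definition power_object ::
  "('o, 'a) cat \<Rightarrow> ('o \<times> 'a set) set \<Rightarrow> ('o, 'a, 'x) psh \<Rightarrow> ('o, 'a, ('a \<times> 'x) set) psh" where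
  "power_object C J X = \<lparr>
     pobj = (\<lambda>d. {s.
       (\<forall>g x. (g, x) \<in> s \<longrightarrow> g \<in> max_sieve C d \<and> x \<in> pobj X (Dom C g) \<and>
          (\<forall>u\<in>max_sieve C (Dom C g). (Comp C g u, pmap X u x) \<in> s)) \<and>
       (\<forall>g\<in>max_sieve C d. \<forall>x\<in>pobj X (Dom C g).
          (Dom C g, {u \<in> max_sieve C (Dom C g). (Comp C g u, pmap X u x) \<in> s}) \<in> J \<longrightarrow> (g, x) \<in> s)}),
     pmap = (\<lambda>f s. {(g, x). g \<in> max_sieve C (Dom C f) \<and> (Comp C f g, x) \<in> s})\<rparr>"

context site
begin

lemma in_pmap_power [simp]:
  "(g, x) \<in> pmap (power_object C J X) f s \<longleftrightarrow>
     g \<in> Arr C \<and> Cod C g = Dom C f \<and> (Comp C f g, x) \<in> s"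
  by (simp add: power_object_def)

lemma power_iff:
  "s \<in> pobj (power_object C J X) d \<longleftrightarrow>
     (\<forall>g x. (g, x) \<in> s \<longrightarrow> g \<in> max_sieve C d \<and> x \<in> pobj X (Dom C g) \<and>
        (\<forall>u\<in>max_sieve C (Dom C g). (Comp C g u, pmap X u x) \<in> s)) \<and>
     (\<forall>g\<in>max_sieve C d. \<forall>x\<in>pobj X (Dom C g).
        (Dom C g, {u \<in> max_sieve C (Dom C g). (Comp C g u, pmap X u x) \<in> s}) \<in> J \<longrightarrow> (g, x) \<in> s)"
  unfolding power_object_def psh.simps mem_Collect_eq by (rule refl)

lemma
  assumes s: "s \<in> pobj (power_object C J X) d" and gx: "(g, x) \<in> s"
  shows power_arr: "g \<in> Arr C" and power_cod: "Cod C g = d" and power_val: "x \<in> pobj X (Dom C g)"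
    and power_comp: "u \<in> Arr C \<Longrightarrow> Cod C u = Dom C g \<Longrightarrow> (Comp C g u, pmap X u x) \<in> s"
proof -
  have "g \<in> max_sieve C d" "x \<in> pobj X (Dom C g)"
    and comp: "\<forall>u\<in>max_sieve C (Dom C g). (Comp C g u, pmap X u x) \<in> s"
    using conjunct1[OF s[unfolded power_iff], rule_format, OF gx] by blast+
  then show "g \<in> Arr C" "Cod C g = d" "x \<in> pobj X (Dom C g)" by simp_all
  show "u \<in> Arr C \<Longrightarrow> Cod C u = Dom C g \<Longrightarrow> (Comp C g u, pmap X u x) \<in> s"
    using comp[THEN bspec, of u] by simp
qed

lemma power_local:
  assumes s: "s \<in> pobj (power_object C J X) d" and g: "g \<in> Arr C" "Cod C g = d"
    and x: "x \<in> pobj X (Dom C g)"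
    and cov: "(Dom C g, {u \<in> max_sieve C (Dom C g). (Comp C g u, pmap X u x) \<in> s}) \<in> J"
  shows "(g, x) \<in> s"
  using conjunct2[OF s[unfolded power_iff], rule_format, OF _ x cov] g by simp

lemma powerI:
  assumes "\<And>g x. (g, x) \<in> s \<Longrightarrow> g \<in> Arr C \<and> Cod C g = d \<and> x \<in> pobj X (Dom C g)"
    and "\<And>g x u. (g, x) \<in> s \<Longrightarrow> u \<in> Arr C \<Longrightarrow> Cod C u = Dom C g \<Longrightarrow>
      (Comp C g u, pmap X u x) \<in> s"
    and "\<And>g x. g \<in> Arr C \<Longrightarrow> Cod C g = d \<Longrightarrow> x \<in> pobj X (Dom C g) \<Longrightarrow>
      (Dom C g, {u \<in> max_sieve C (Dom C g). (Comp C g u, pmap X u x) \<in> s}) \<in> J \<Longrightarrow> (g, x) \<in> s"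
  shows "s \<in> pobj (power_object C J X) d"
  unfolding power_iff
proof (intro conjI allI impI ballI)
  fix g x assume gx: "(g, x) \<in> s"
  from assms(1)[OF gx] show "g \<in> max_sieve C d" "x \<in> pobj X (Dom C g)" by simp_all
  fix u assume "u \<in> max_sieve C (Dom C g)"
  with assms(2)[OF gx] show "(Comp C g u, pmap X u x) \<in> s" by simp
next
  fix g x assume g: "g \<in> max_sieve C d" and x: "x \<in> pobj X (Dom C g)"
    and cov: "(Dom C g, {u \<in> max_sieve C (Dom C g). (Comp C g u, pmap X u x) \<in> s}) \<in> J"
  from assms(3)[OF _ _ x cov] g show "(g, x) \<in> s" by simp
qed

lemma power_mem_iff:
  assumes X: "presheaf C X" and s: "s \<in> pobj (power_object C J X) d" and R: "(Dom C g, R) \<in> J"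
    and g: "g \<in> Arr C" "Cod C g = d" and x: "x \<in> pobj X (Dom C g)"
  shows "(g, x) \<in> s \<longleftrightarrow> (\<forall>u\<in>R. (Comp C g u, pmap X u x) \<in> s)"
proof
  assume gx: "(g, x) \<in> s"
  show "\<forall>u\<in>R. (Comp C g u, pmap X u x) \<in> s"
    using power_comp[OF s gx] sieve_arr[OF cover_sieve[OF R]] by simp
next
  assume *: "\<forall>u\<in>R. (Comp C g u, pmap X u x) \<in> s"
  let ?U = "{u \<in> max_sieve C (Dom C g). (Comp C g u, pmap X u x) \<in> s}"
  have "sieve C (Dom C g) ?U"
  proof (rule sieveI)
    fix u v assume u: "u \<in> ?U" and v: "v \<in> Arr C" "Cod C v = Dom C u"
    then have "(Comp C (Comp C g u) v, pmap X v (pmap X u x)) \<in> s"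
      using g power_comp[OF s, of "Comp C g u" "pmap X u x" v] by simp
    then show "Comp C u v \<in> ?U" using psh_comp[OF X] u v x g by simp
  qed auto
  moreover have "R \<subseteq> ?U" using * sieve_arr[OF cover_sieve[OF R]] by auto
  ultimately have "(Dom C g, ?U) \<in> J" by (rule cover_mono[OF R])
  then show "(g, x) \<in> s" by (rule power_local[OF s g x])
qed

lemma power_presheaf:
  assumes X: "presheaf C X"
  shows "presheaf C (power_object C J X)"
proof (rule presheafI)
  fix f s assume f: "f \<in> Arr C" and s: "s \<in> pobj (power_object C J X) (Cod C f)"
  show "pmap (power_object C J X) f s \<in> pobj (power_object C J X) (Dom C f)"
  proof (rule powerI)
    fix g x assume gx: "g \<in> Arr C" "Cod C g = Dom C f" "x \<in> pobj X (Dom C g)"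
    have "{u \<in> max_sieve C (Dom C g). (Comp C g u, pmap X u x) \<in> pmap (power_object C J X) f s}
        = {u \<in> max_sieve C (Dom C g). (Comp C (Comp C f g) u, pmap X u x) \<in> s}"
      using f gx by auto
    moreover assume "(Dom C g, {u \<in> max_sieve C (Dom C g).
      (Comp C g u, pmap X u x) \<in> pmap (power_object C J X) f s}) \<in> J"
    ultimately show "(g, x) \<in> pmap (power_object C J X) f s"
      using power_local[OF s, of "Comp C f g" x] f gx by simp
  next
    fix g x u assume "(g, x) \<in> pmap (power_object C J X) f s" "u \<in> Arr C" "Cod C u = Dom C g"
    then show "(Comp C g u, pmap X u x) \<in> pmap (power_object C J X) f s"
      using f power_comp[OF s, of "Comp C f g" x u] by simp
  next
    fix g x assume gx: "(g, x) \<in> pmap (power_object C J X) f s"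
    then show "g \<in> Arr C \<and> Cod C g = Dom C f \<and> x \<in> pobj X (Dom C g)"
      using f power_val[OF s, of "Comp C f g" x] by simp
  qed
next
  fix c s assume c: "c \<in> Obj C" and s: "s \<in> pobj (power_object C J X) c"
  show "pmap (power_object C J X) (Id C c) s = s"
  proof (intro equalityI subrelI)
    fix g x assume "(g, x) \<in> pmap (power_object C J X) (Id C c) s"
    then show "(g, x) \<in> s" using c by auto
  next
    fix g x assume gx: "(g, x) \<in> s"
    then show "(g, x) \<in> pmap (power_object C J X) (Id C c) s"
      using c power_arr[OF s gx] power_cod[OF s gx] by simp
  qed
qed auto

text \<open>An amalgamation of a matching family \<open>t\<close> on \<open>R\<close> consists of the \<open>(g, x)\<close> that belong to the family locally.
  To ask whether \<open>(g, x)\<close> restricted along \<open>u\<close> with \<open>g u \<in> R\<close> belongs to it, one looks for the identity paired with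
  the restriction of \<open>x\<close> in \<open>t (g u)\<close>.\<close>

lemma power_Sh:
  assumes X: "presheaf C X"
  shows "power_object C J X \<in> Sh C J"
proof (rule ShI)
  let ?P = "power_object C J X"
  note psh = power_presheaf[OF X]
  show "presheaf C ?P" by (rule psh)
  show "s = s'"
    if R: "(d, R) \<in> J" and s: "s \<in> pobj ?P d" and s': "s' \<in> pobj ?P d"
      and eq: "\<And>f. f \<in> R \<Longrightarrow> pmap ?P f s = pmap ?P f s'" for d R s s'
  proof -
    have "(g, x) \<in> s \<longleftrightarrow> (g, x) \<in> s'" if g: "g \<in> Arr C" "Cod C g = d" and x: "x \<in> pobj X (Dom C g)" for g x
    proof -
      have R': "(Dom C g, pull C g R) \<in> J" using cover_pull[OF R] g by simp
      have "(Comp C g u, pmap X u x) \<in> s \<longleftrightarrow> (Comp C g u, pmap X u x) \<in> s'" if "u \<in> pull C g R" for u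
      proof -
        have "(Id C (Dom C u), pmap X u x) \<in> pmap ?P (Comp C g u) s \<longleftrightarrow>
            (Id C (Dom C u), pmap X u x) \<in> pmap ?P (Comp C g u) s'"
          using eq[of "Comp C g u"] that by simp
        then show ?thesis using that g by simp
      qed
      then show ?thesis
        using power_mem_iff[OF X s R' g x] power_mem_iff[OF X s' R' g x] by simp
    qed
    then show "s = s'"
      by (intro equalityI subrelI)
        (use power_arr[OF s] power_cod[OF s] power_val[OF s]
          power_arr[OF s'] power_cod[OF s'] power_val[OF s'] in blast)+
  qed
  show "\<exists>s\<in>pobj ?P d. \<forall>f\<in>R. pmap ?P f s = t f"
    if R: "(d, R) \<in> J" and t: "matching_family C ?P R t" for d R t
  proof -
    have t_in: "t f \<in> pobj ?P (Dom C f)" if "f \<in> R" for f using matching_family_in[OF t that] .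
    have t_map: "(g, x) \<in> t (Comp C f u) \<longleftrightarrow> g \<in> Arr C \<and> Cod C g = Dom C u \<and> (Comp C u g, x) \<in> t f"
      if "f \<in> R" "u \<in> Arr C" "Cod C u = Dom C f" for f u g x
      using matching_family_map[OF t that] by (metis in_pmap_power)
    define T where "T g x = {u \<in> max_sieve C (Dom C g). Comp C g u \<in> R \<and>
      (Id C (Dom C u), pmap X u x) \<in> t (Comp C g u)}" for g x
    note sR = cover_sieve[OF R]
    have T_comp: "T (Comp C g u) (pmap X u x) = pull C u (T g x)"
      if "g \<in> Arr C" "x \<in> pobj X (Dom C g)" "u \<in> Arr C" "Cod C u = Dom C g" for g x u
      using that psh_comp[OF X] by (auto simp: T_def)
    have T_sieve: "sieve C (Dom C g) (T g x)" if g: "g \<in> Arr C" and x: "x \<in> pobj X (Dom C g)" for g x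
    proof (rule sieveI)
      fix u v assume u: "u \<in> T g x" and v: "v \<in> Arr C" "Cod C v = Dom C u"
      then have gu: "Comp C g u \<in> R" "(Id C (Dom C u), pmap X u x) \<in> t (Comp C g u)"
        "u \<in> Arr C" "Cod C u = Dom C g" by (auto simp: T_def)
      then have "(Comp C (Id C (Dom C u)) v, pmap X v (pmap X u x)) \<in> t (Comp C g u)"
        using v g power_comp[OF t_in[OF gu(1)] gu(2)] by simp
      then have "(Id C (Dom C v), pmap X (Comp C u v) x) \<in> t (Comp C (Comp C g u) v)"
        using t_map[OF gu(1) v(1)] v g gu x psh_comp[OF X] by simp
      moreover have "Comp C (Comp C g u) v \<in> R" using sieve_comp[OF sR gu(1)] v g gu by simp
      ultimately show "Comp C u v \<in> T g x" using u v g gu by (simp add: T_def)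
    qed (auto simp: T_def)
    define s where "s = {(g, x). g \<in> max_sieve C d \<and> x \<in> pobj X (Dom C g) \<and> (Dom C g, T g x) \<in> J}"
    have "s \<in> pobj ?P d"
    proof (rule powerI)
      fix g x u assume "(g, x) \<in> s" "u \<in> Arr C" "Cod C u = Dom C g"
      then show "(Comp C g u, pmap X u x) \<in> s"
        using psh_in[OF X, of u x] T_comp[of g x u] cover_pull[of "Dom C g" "T g x" u]
        by (simp add: s_def)
    next
      fix g x assume g: "g \<in> Arr C" "Cod C g = d" and x: "x \<in> pobj X (Dom C g)"
        and cov: "(Dom C g, {u \<in> max_sieve C (Dom C g). (Comp C g u, pmap X u x) \<in> s}) \<in> J"
      have "(Dom C g, T g x) \<in> J"
        by (rule cover_trans[OF cov T_sieve[OF g(1) x]]) (use g x T_comp in \<open>auto simp: s_def\<close>)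
      then show "(g, x) \<in> s" using g x by (simp add: s_def)
    qed (auto simp: s_def)
    moreover have "pmap ?P f s = t f" if f: "f \<in> R" for f
    proof -
      have fa: "f \<in> Arr C" "Cod C f = d" using sieve_arr[OF sR f] by auto
      have "(g, x) \<in> pmap ?P f s \<longleftrightarrow> (g, x) \<in> t f"
        if g: "g \<in> Arr C" "Cod C g = Dom C f" and x: "x \<in> pobj X (Dom C g)" for g x
      proof -
        have "T (Comp C f g) x = {u \<in> max_sieve C (Dom C g). (Comp C g u, pmap X u x) \<in> t f}"
          using g fa sieve_comp[OF sR f] t_map[OF f] by (auto simp: T_def)
        moreover have "(Dom C g, {u \<in> max_sieve C (Dom C g). (Comp C g u, pmap X u x) \<in> t f}) \<in> J \<longleftrightarrow> (g, x) \<in> t f"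
        proof
          assume gx: "(g, x) \<in> t f"
          have "{u \<in> max_sieve C (Dom C g). (Comp C g u, pmap X u x) \<in> t f} = max_sieve C (Dom C g)"
            using power_comp[OF t_in[OF f] gx] by auto
          then show "(Dom C g, {u \<in> max_sieve C (Dom C g). (Comp C g u, pmap X u x) \<in> t f}) \<in> J"
            using cover_max g by simp
        qed (rule power_local[OF t_in[OF f] g x])
        ultimately show ?thesis using g x fa by (simp add: s_def)
      qed
      moreover have "x \<in> pobj X (Dom C g)" if "(g, x) \<in> pmap ?P f s" for g x
        using that fa by (auto simp: s_def)
      ultimately show ?thesis
        by (intro equalityI subrelI)
          (use power_arr[OF t_in[OF f]] power_cod[OF t_in[OF f]] power_val[OF t_in[OF f]]
            in_pmap_power[of _ _ X f s] in blast)+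
    qed
    ultimately show ?thesis by blast
  qed
qed

section \<open>A topology is determined by its sheaves\<close>

lemma terminal_presheaf: "presheaf C terminal"
  by (rule presheafI) (simp_all add: terminal_def)

end

text \<open>The subobject classifier of the \<open>K\<close>-sheaves is, by assumption, a \<open>K'\<close>-sheaf. For \<open>R\<close> in \<open>K'\<close>, the
  \<open>K\<close>-closure of \<open>R\<close> and the maximal sieve agree when pulled back along any \<open>f \<in> R\<close>, so they are equal,
  that is, \<open>R\<close> is in \<open>K\<close>.\<close>

lemma topology_subset_if_Sh_subset:
  fixes C :: "('o, 'a) cat"
  assumes "category C" "grothendieck_topology C K" "grothendieck_topology C K'"
    and Sh: "(Sh C K :: ('o, 'a, 'v) psh set) \<subseteq> Sh C K'"
    and \<iota>: "inj (\<iota> :: ('a \<times> unit) set \<Rightarrow> 'v)"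
  shows "K' \<subseteq> K"
proof clarify
  interpret category C by fact
  interpret K: site C K by unfold_locales fact
  interpret K': site C K' by unfold_locales fact
  let ?P = "power_object C K (terminal :: ('o, 'a, unit) psh)"
  fix c R assume R: "(c, R) \<in> K'"
  note c = K'.cover_obj[OF R] and sR = K'.cover_sieve[OF R]
  have P: "S \<times> {()} \<in> pobj ?P c" if S: "closed_sieve C K c S" for S
  proof (rule K.powerI)
    have sv: "sieve C c S" using S by (simp add: closed_sieve_def)
    show "g \<in> Arr C \<and> Cod C g = c \<and> x \<in> pobj terminal (Dom C g)" if "(g, x) \<in> S \<times> {()}" for g x
      using that sieve_arr[OF sv] by (auto simp: terminal_def)
    show "(Comp C g u, pmap terminal u x) \<in> S \<times> {()}"
      if "(g, x) \<in> S \<times> {()}" "u \<in> Arr C" "Cod C u = Dom C g" for g x u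
      using that sieve_comp[OF sv] by auto
    show "(g, x) \<in> S \<times> {()}" if "g \<in> Arr C" "Cod C g = c"
      "(Dom C g, {u \<in> max_sieve C (Dom C g). (Comp C g u, pmap terminal u x) \<in> S \<times> {()}}) \<in> K" for g x
      using K.closed_sieveD[OF S that(1,2)] that(3) by (simp add: pull_def)
  qed
  have "psh_image \<iota> ?P \<in> Sh C K'"
    using K.psh_image_Sh[OF \<iota> K.power_Sh[OF K.terminal_presheaf]] Sh by blast
  moreover have "\<iota> (sieve_closure C K c R \<times> {()}) \<in> pobj (psh_image \<iota> ?P) c"
    and "\<iota> (max_sieve C c \<times> {()}) \<in> pobj (psh_image \<iota> ?P) c"
    using P K.sieve_closure_closed[OF sR] K.closed_sieve_max by simp_all
  moreover have "pmap (psh_image \<iota> ?P) f (\<iota> (sieve_closure C K c R \<times> {()}))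
      = pmap (psh_image \<iota> ?P) f (\<iota> (max_sieve C c \<times> {()}))" if f: "f \<in> R" for f
  proof -
    have "Comp C f g \<in> sieve_closure C K c R" if "g \<in> Arr C" "Cod C g = Dom C f" for g
      using sieve_comp[OF sR f that] K.sieve_closure_subset[OF sR] by blast
    then have "pmap ?P f (sieve_closure C K c R \<times> {()}) = pmap ?P f (max_sieve C c \<times> {()})"
      using sieve_arr[OF sR f] by auto
    then show ?thesis using \<iota> by simp
  qed
  ultimately have "\<iota> (sieve_closure C K c R \<times> {()}) = \<iota> (max_sieve C c \<times> {()})"
    by (rule K'.Sh_eqI[OF _ R])
  then have "sieve_closure C K c R = max_sieve C c"
    using \<iota> by (auto simp: inj_eq simp del: in_max_sieve)
  then show "(c, R) \<in> K" using K.sieve_closure_eq_max_iff[OF sR c] by simp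
qed

section \<open>The sheaf generated by a sieve\<close>

definition hom_psh :: "('o, 'a) cat \<Rightarrow> 'o \<Rightarrow> ('o, 'a, 'a) psh" where
  "hom_psh C c = \<lparr>pobj = (\<lambda>d. {h \<in> max_sieve C c. Dom C h = d}), pmap = (\<lambda>u h. Comp C h u)\<rparr>"

definition agree :: "('o, 'a) cat \<Rightarrow> 'a \<Rightarrow> 'a \<Rightarrow> 'a set" where
  "agree C h h' = {u \<in> max_sieve C (Dom C h). Comp C h u = Comp C h' u}"

text \<open>The sheafification of the subpresheaf \<open>R\<close> of the representable of \<open>c\<close>, inside the power object of that
  representable. An element at \<open>d\<close> is a relation between arrows into \<open>d\<close> and arrows into \<open>c\<close> that is locally
  functional and whose values lie in \<open>R\<close> on a cover: a locally defined arrow from \<open>d\<close> to \<open>c\<close>. For maximal \<open>R\<close> it is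
  the sheafified representable.\<close>

definition sheafified_sieve ::
  "('o, 'a) cat \<Rightarrow> ('o \<times> 'a set) set \<Rightarrow> 'o \<Rightarrow> 'a set \<Rightarrow> 'o \<Rightarrow> ('a \<times> 'a) set set" where
  "sheafified_sieve C J c R d = {s \<in> pobj (power_object C J (hom_psh C c)) d.
     (\<forall>g h h'. (g, h) \<in> s \<longrightarrow> (g, h') \<in> s \<longrightarrow> (Dom C g, agree C h h') \<in> J) \<and>
     (d, {g. \<exists>h\<in>R. (g, h) \<in> s}) \<in> J}"

text \<open>The image of the identity of \<open>c\<close> in the sheafified representable: equality of arrows up to a cover.\<close>

definition generic_element :: "('o, 'a) cat \<Rightarrow> ('o \<times> 'a set) set \<Rightarrow> 'o \<Rightarrow> ('a \<times> 'a) set" where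
  "generic_element C J c = {(g, h). g \<in> max_sieve C c \<and> h \<in> max_sieve C c \<and> Dom C g = Dom C h \<and>
     (Dom C g, agree C g h) \<in> J}"

context site
begin

lemma hom_psh_simps [simp]:
  "h \<in> pobj (hom_psh C c) d \<longleftrightarrow> h \<in> Arr C \<and> Cod C h = c \<and> Dom C h = d"
  "pmap (hom_psh C c) u h = Comp C h u"
  by (auto simp: hom_psh_def)

lemma hom_psh_presheaf: "presheaf C (hom_psh C c)"
  by (rule presheafI) simp_all

lemma in_agree:
  "u \<in> agree C h h' \<longleftrightarrow> u \<in> Arr C \<and> Cod C u = Dom C h \<and> Comp C h u = Comp C h' u"
  by (simp add: agree_def)

lemma agree_sieve:
  assumes "h \<in> Arr C" "h' \<in> Arr C" "Dom C h = Dom C h'"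
  shows "sieve C (Dom C h) (agree C h h')"
proof (rule sieveI)
  fix u v assume u: "u \<in> agree C h h'" and v: "v \<in> Arr C" "Cod C v = Dom C u"
  from u have ua: "u \<in> Arr C" "Cod C u = Dom C h" "Comp C h u = Comp C h' u"
    by (simp_all add: in_agree)
  from ua(3) have "Comp C (Comp C h u) v = Comp C (Comp C h' u) v" by simp
  then show "Comp C u v \<in> agree C h h'" using ua(1,2) v assms by (simp add: in_agree)
qed (auto simp: in_agree)

lemma pull_agree:
  assumes "h \<in> Arr C" "h' \<in> Arr C" "Dom C h = Dom C h'" "u \<in> Arr C" "Cod C u = Dom C h"
  shows "pull C u (agree C h h') = agree C (Comp C h u) (Comp C h' u)"
  using assms by (auto simp: in_agree)

lemma agree_refl: "agree C h h = max_sieve C (Dom C h)"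
  by (simp add: agree_def del: in_max_sieve)

abbreviation "hom_power c \<equiv> power_object C J (hom_psh C c)"

lemmas hom_power_Sh = power_Sh[OF hom_psh_presheaf]

lemma
  assumes "s \<in> pobj (hom_power c) d" "(g, h) \<in> s"
  shows hom_power_arr: "g \<in> Arr C" "Cod C g = d" "h \<in> Arr C" "Cod C h = c" "Dom C h = Dom C g"
    and hom_power_comp: "u \<in> Arr C \<Longrightarrow> Cod C u = Dom C g \<Longrightarrow> (Comp C g u, Comp C h u) \<in> s"
  using power_arr[OF assms] power_cod[OF assms] power_val[OF assms] power_comp[OF assms] by simp_all

lemma support_sieve:
  assumes s: "s \<in> pobj (hom_power c) d" and R: "sieve C c R"
  shows "sieve C d {g. \<exists>h\<in>R. (g, h) \<in> s}"
proof (rule sieveI)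
  fix g u assume "g \<in> {g. \<exists>h\<in>R. (g, h) \<in> s}" and u: "u \<in> Arr C" "Cod C u = Dom C g"
  then obtain h where h: "h \<in> R" "(g, h) \<in> s" by blast
  note a = hom_power_arr[OF s h(2)]
  have "Comp C h u \<in> R" "(Comp C g u, Comp C h u) \<in> s"
    using sieve_comp[OF R h(1)] hom_power_comp[OF s h(2)] u a by simp_all
  then show "Comp C g u \<in> {g. \<exists>h\<in>R. (g, h) \<in> s}" by blast
next
  fix g assume "g \<in> {g. \<exists>h\<in>R. (g, h) \<in> s}"
  then obtain h where h: "(g, h) \<in> s" by blast
  show "g \<in> Arr C \<and> Cod C g = d" using hom_power_arr[OF s h] by simp
qed

lemma pull_support:
  assumes f: "f \<in> Arr C"
  shows "{g. \<exists>h\<in>R. (g, h) \<in> pmap (hom_power c) f s} = pull C f {g. \<exists>h\<in>R. (g, h) \<in> s}"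
  using f by auto

lemma
  assumes "s \<in> sheafified_sieve C J c R d"
  shows sheafified_in: "s \<in> pobj (hom_power c) d"
    and sheafified_agree: "(g, h) \<in> s \<Longrightarrow> (g, h') \<in> s \<Longrightarrow> (Dom C g, agree C h h') \<in> J"
    and sheafified_cover: "(d, {g. \<exists>h\<in>R. (g, h) \<in> s}) \<in> J"
  using assms unfolding sheafified_sieve_def by blast+

lemma sheafifiedI:
  assumes "s \<in> pobj (hom_power c) d"
    and "\<And>g h h'. (g, h) \<in> s \<Longrightarrow> (g, h') \<in> s \<Longrightarrow> (Dom C g, agree C h h') \<in> J"
    and "(d, {g. \<exists>h\<in>R. (g, h) \<in> s}) \<in> J"
  shows "s \<in> sheafified_sieve C J c R d"
  using assms unfolding sheafified_sieve_def by blast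

lemma sheafified_subsheaf:
  assumes R: "sieve C c R"
  shows "subsheaf C J (hom_power c) (sheafified_sieve C J c R)"
proof (rule subsheafI[OF hom_power_Sh])
  note psh = Sh_presheaf[OF hom_power_Sh]
  show "sheafified_sieve C J c R d \<subseteq> pobj (hom_power c) d" for d
    using sheafified_in by blast
  show "pmap (hom_power c) f s \<in> sheafified_sieve C J c R (Dom C f)"
    if f: "f \<in> Arr C" and s: "s \<in> sheafified_sieve C J c R (Cod C f)" for f s
  proof (rule sheafifiedI)
    show "pmap (hom_power c) f s \<in> pobj (hom_power c) (Dom C f)"
      by (rule psh_in[OF psh f sheafified_in[OF s]])
    show "(Dom C g, agree C h h') \<in> J"
      if "(g, h) \<in> pmap (hom_power c) f s" "(g, h') \<in> pmap (hom_power c) f s" for g h h'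
      using that f sheafified_agree[OF s, of "Comp C f g" h h'] by simp
    show "(Dom C f, {g. \<exists>h\<in>R. (g, h) \<in> pmap (hom_power c) f s}) \<in> J"
      unfolding pull_support[OF f] by (rule cover_pull[OF sheafified_cover[OF s]]) (simp add: f)
  qed
  show "s \<in> sheafified_sieve C J c R d"
    if T: "(d, T) \<in> J" and s: "s \<in> pobj (hom_power c) d"
      and loc: "\<And>f. f \<in> T \<Longrightarrow> pmap (hom_power c) f s \<in> sheafified_sieve C J c R (Dom C f)" for d T s
  proof (rule sheafifiedI[OF s])
    note sT = cover_sieve[OF T]
    show "(Dom C g, agree C h h') \<in> J" if gh: "(g, h) \<in> s" "(g, h') \<in> s" for g h h'
    proof -
      note a = hom_power_arr[OF s gh(1)] hom_power_arr[OF s gh(2)]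
      have T': "(Dom C g, pull C g T) \<in> J" using cover_pull[OF T] a by simp
      have sv: "sieve C (Dom C g) (agree C h h')" using agree_sieve[of h h'] a by simp
      show ?thesis
      proof (rule cover_trans[OF T' sv])
        fix u assume u: "u \<in> pull C g T"
        then have ua: "u \<in> Arr C" "Cod C u = Dom C g" and gu: "Comp C g u \<in> T" by auto
        have "(Id C (Dom C u), Comp C h u) \<in> pmap (hom_power c) (Comp C g u) s"
          "(Id C (Dom C u), Comp C h' u) \<in> pmap (hom_power c) (Comp C g u) s"
          using hom_power_comp[OF s gh(1) ua] hom_power_comp[OF s gh(2) ua] ua a by simp_all
        from sheafified_agree[OF loc[OF gu] this]
        show "(Dom C u, pull C u (agree C h h')) \<in> J"
          using pull_agree[of h h' u] ua a by simp
      qed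
    qed
    show "(d, {g. \<exists>h\<in>R. (g, h) \<in> s}) \<in> J"
    proof (rule cover_trans[OF T support_sieve[OF s R]])
      fix f assume f: "f \<in> T"
      have fa: "f \<in> Arr C" using sieve_arr[OF sT f] by simp
      show "(Dom C f, pull C f {g. \<exists>h\<in>R. (g, h) \<in> s}) \<in> J"
        using sheafified_cover[OF loc[OF f]] unfolding pull_support[OF fa] .
    qed
  qed
qed

abbreviation "hom_sheaf c \<equiv> (hom_power c)\<lparr>pobj := sheafified_sieve C J c (max_sieve C c)\<rparr>"

lemma hom_sheaf_Sh: "hom_sheaf c \<in> Sh C J"
  using sheafified_subsheaf[OF sieve_max] by (simp add: subsheaf_def)

lemma sheafified_subset:
  assumes R: "sieve C c R"
  shows "sheafified_sieve C J c R d \<subseteq> sheafified_sieve C J c (max_sieve C c) d"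
proof
  fix s assume s: "s \<in> sheafified_sieve C J c R d"
  show "s \<in> sheafified_sieve C J c (max_sieve C c) d"
  proof (rule sheafifiedI[OF sheafified_in[OF s] sheafified_agree[OF s]])
    have "{g. \<exists>h\<in>R. (g, h) \<in> s} \<subseteq> {g. \<exists>h\<in>max_sieve C c. (g, h) \<in> s}"
      using R unfolding sieve_def by blast
    then show "(d, {g. \<exists>h\<in>max_sieve C c. (g, h) \<in> s}) \<in> J"
      by (rule cover_mono[OF sheafified_cover[OF s] support_sieve[OF sheafified_in[OF s] sieve_max]])
  qed
qed

lemma sheafified_subsheaf_hom:
  assumes "sieve C c R"
  shows "subsheaf C J (hom_sheaf c) (sheafified_sieve C J c R)"
  using sheafified_subsheaf[OF assms] sheafified_subset[OF assms] by (simp add: subsheaf_def)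

text \<open>An element \<open>s\<close> is given on a cover by honest arrows \<open>h\<close> into \<open>c\<close>, and along \<open>h\<close> the dense sieve \<open>R\<close> pulls back to
  a dense sieve, on which \<open>s\<close> has values in \<open>R\<close>.\<close>

lemma sheafified_dense:
  assumes j: "local_operator C J j" and R: "(c, R) \<in> dense_sieves C J j"
  shows "j_dense C j (hom_sheaf c) (sheafified_sieve C J c R)"
proof -
  let ?K = "dense_sieves C J j" and ?A = "sheafified_sieve C J c R"
  interpret K: site C ?K by unfold_locales (rule dense_sieves_topology[OF j])
  note sR = K.cover_sieve[OF R] and c = K.cover_obj[OF R]
  note psh = Sh_presheaf[OF hom_sheaf_Sh]
  note A = sheafified_subsheaf_hom[OF sR]
  have "j d {f \<in> max_sieve C d. pmap (hom_power c) f s \<in> ?A (Dom C f)} = max_sieve C d"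
    (is "j d ?X = _")
    if d: "d \<in> Obj C" and s: "s \<in> sheafified_sieve C J c (max_sieve C c) d" for d s
  proof -
    have cl: "closed_sieve C J d ?X"
      using closed_sieve_char[OF hom_sheaf_Sh A, of s d] s by simp
    then have sX: "sieve C d ?X" by (simp add: closed_sieve_def)
    note sP = sheafified_in[OF s]
    have "(d, {g. \<exists>h\<in>max_sieve C c. (g, h) \<in> s}) \<in> ?K"
      using sheafified_cover[OF s] subset_dense_sieves[OF j] by blast
    then have "(d, ?X) \<in> ?K"
    proof (rule K.cover_trans[OF _ sX])
      fix g assume "g \<in> {g. \<exists>h\<in>max_sieve C c. (g, h) \<in> s}"
      then obtain h where gh: "(g, h) \<in> s" by blast
      note a = hom_power_arr[OF sP gh]
      have "(Dom C g, pull C h R) \<in> ?K" using K.cover_pull[OF R, of h] a by simp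
      moreover have "sieve C (Dom C g) (pull C g ?X)" using sieve_pull[OF sX, of g] a by simp
      moreover have "pull C h R \<subseteq> pull C g ?X"
      proof
        fix w assume "w \<in> pull C h R"
        then have w: "w \<in> Arr C" "Cod C w = Dom C g" and hw: "Comp C h w \<in> R" using a by auto
        let ?gw = "Comp C g w"
        have gw: "?gw \<in> Arr C" "Cod C ?gw = d" "Dom C ?gw = Dom C w" using w a by simp_all
        have t: "pmap (hom_power c) ?gw s \<in> sheafified_sieve C J c (max_sieve C c) (Dom C ?gw)"
          using psh_in[OF psh gw(1), of s] gw(2) s by simp
        have "pmap (hom_power c) ?gw s \<in> ?A (Dom C ?gw)"
        proof (rule sheafifiedI[OF sheafified_in[OF t] sheafified_agree[OF t]])
          have "(Id C (Dom C w), Comp C h w) \<in> pmap (hom_power c) ?gw s"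
            using hom_power_comp[OF sP gh w] gw w a by simp
          then have "Id C (Dom C ?gw) \<in> {g. \<exists>h\<in>R. (g, h) \<in> pmap (hom_power c) ?gw s}"
            using hw gw by auto
          then show "(Dom C ?gw, {g. \<exists>h\<in>R. (g, h) \<in> pmap (hom_power c) ?gw s}) \<in> J"
            by (intro cover_if_id support_sieve[OF sheafified_in[OF t] sR]) (use gw w(1) in simp_all)
        qed
        then show "w \<in> pull C g ?X" using w gw by simp
      qed
      ultimately show "(Dom C g, pull C g ?X) \<in> ?K" by (rule K.cover_mono)
    qed
    then show ?thesis by (simp add: dense_sieves_def sieve_closure_id[OF cl] del: in_max_sieve)
  qed
  then show ?thesis by (simp add: dense_iff del: in_max_sieve)
qed

lemma generic_element_in:
  assumes c: "c \<in> Obj C"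
  shows "generic_element C J c \<in> sheafified_sieve C J c (max_sieve C c) c"
proof (rule sheafifiedI)
  let ?u = "generic_element C J c"
  have mem: "(g, h) \<in> ?u \<longleftrightarrow> g \<in> Arr C \<and> Cod C g = c \<and> h \<in> Arr C \<and> Cod C h = c \<and>
      Dom C g = Dom C h \<and> (Dom C g, agree C g h) \<in> J" for g h
    by (auto simp: generic_element_def)
  show P: "?u \<in> pobj (hom_power c) c"
  proof (rule powerI)
    fix g h v assume gh: "(g, h) \<in> ?u" and v: "v \<in> Arr C" "Cod C v = Dom C g"
    note a = gh[unfolded mem]
    have "(Dom C g, agree C g h) \<in> J" using a by blast
    then have "(Dom C v, pull C v (agree C g h)) \<in> J" using v by (intro cover_pull[of "Dom C g"]) simp_all
    moreover have "pull C v (agree C g h) = agree C (Comp C g v) (Comp C h v)"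
      by (rule pull_agree) (use a v in simp_all)
    ultimately show "(Comp C g v, pmap (hom_psh C c) v h) \<in> ?u"
      using a v by (simp add: mem)
  next
    fix g h assume g: "g \<in> Arr C" "Cod C g = c" and h: "h \<in> pobj (hom_psh C c) (Dom C g)"
      and cov: "(Dom C g, {v \<in> max_sieve C (Dom C g). (Comp C g v, pmap (hom_psh C c) v h) \<in> ?u}) \<in> J"
    have "(Dom C g, agree C g h) \<in> J"
      by (rule cover_trans[OF cov agree_sieve])
        (use g h pull_agree[of g h] in \<open>auto simp: mem\<close>)
    then show "(g, h) \<in> ?u" using g h by (simp add: mem)
  qed (auto simp: mem)
  show "(Dom C g, agree C h h') \<in> J" if "(g, h) \<in> ?u" "(g, h') \<in> ?u" for g h h'
  proof (rule cover_mono[OF cover_Int])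
    show "(Dom C g, agree C g h) \<in> J" "(Dom C g, agree C g h') \<in> J" using that by (auto simp: mem)
    show "sieve C (Dom C g) (agree C h h')" using that agree_sieve[of h h'] by (simp add: mem)
    show "agree C g h \<inter> agree C g h' \<subseteq> agree C h h'" using that by (auto simp: mem in_agree)
  qed
  have "(Id C c, Id C c) \<in> ?u" using c cover_max[OF c] by (simp add: mem agree_refl)
  then show "(c, {g. \<exists>h\<in>max_sieve C c. (g, h) \<in> ?u}) \<in> J"
    using c by (intro cover_if_id support_sieve[OF P sieve_max]) auto
qed

lemma generic_element_diag:
  assumes "f \<in> Arr C" "Cod C f = c"
  shows "(Id C (Dom C f), f) \<in> pmap (hom_power c) f (generic_element C J c)"
  using assms cover_max[of "Dom C f"] by (simp add: generic_element_def agree_refl)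

lemma generic_element_restrict:
  assumes R: "sieve C c R" and f: "f \<in> R"
  shows "pmap (hom_power c) f (generic_element C J c) \<in> sheafified_sieve C J c R (Dom C f)"
proof -
  have fa: "f \<in> Arr C" "Cod C f = c" "c \<in> Obj C" using sieve_arr[OF R f] by auto
  have t: "pmap (hom_power c) f (generic_element C J c) \<in> sheafified_sieve C J c (max_sieve C c) (Dom C f)"
    using psh_in[OF Sh_presheaf[OF hom_sheaf_Sh], of f "generic_element C J c" c]
      generic_element_in[OF fa(3)] fa by simp
  show ?thesis
  proof (rule sheafifiedI[OF sheafified_in[OF t] sheafified_agree[OF t]])
    have "Id C (Dom C f) \<in> {g. \<exists>h\<in>R. (g, h) \<in> pmap (hom_power c) f (generic_element C J c)}"
      using generic_element_diag[OF fa(1,2)] f by blast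
    then show "(Dom C f, {g. \<exists>h\<in>R. (g, h) \<in> pmap (hom_power c) f (generic_element C J c)}) \<in> J"
      by (intro cover_if_id support_sieve[OF sheafified_in[OF t] R]) (use fa in simp_all)
  qed
qed

section \<open>Sheaves for the local operator are sheaves for the dense sieves\<close>

text \<open>The condition that \<open>y\<close> is the value at \<open>s\<close> of the map from the sheafification of \<open>R\<close> to \<open>F\<close> that
  corresponds to the family \<open>x\<close>.\<close>

definition glues :: "('o, 'a, 'v) psh \<Rightarrow> 'a set \<Rightarrow> ('a \<Rightarrow> 'v) \<Rightarrow> ('a \<times> 'a) set \<Rightarrow> 'v \<Rightarrow> bool" where
  "glues F R x s y \<longleftrightarrow> (\<forall>g h. (g, h) \<in> s \<longrightarrow> h \<in> R \<longrightarrow> pmap F g y = x h)"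

lemma gluesD: "glues F R x s y \<Longrightarrow> (g, h) \<in> s \<Longrightarrow> h \<in> R \<Longrightarrow> pmap F g y = x h"
  unfolding glues_def by blast

lemma glues_unique:
  assumes F: "F \<in> Sh C J" and s: "s \<in> sheafified_sieve C J c R d"
    and y: "y \<in> pobj F d" "glues F R x s y" and y': "y' \<in> pobj F d" "glues F R x s y'"
  shows "y = y'"
  by (rule Sh_eqI[OF F sheafified_cover[OF s] y(1) y'(1)])
    (auto simp: gluesD[OF y(2)] gluesD[OF y'(2)])

lemma glues_exists:
  assumes F: "F \<in> Sh C J" and R: "sieve C c R" and x: "matching_family C F R x"
    and s: "s \<in> sheafified_sieve C J c R d"
  shows "\<exists>y\<in>pobj F d. glues F R x s y"
proof -
  let ?T = "{g. \<exists>h\<in>R. (g, h) \<in> s}"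
  note sP = sheafified_in[OF s] and psh = Sh_presheaf[OF F]
  have wd: "x h = x h'" if "(g, h) \<in> s" "h \<in> R" "(g, h') \<in> s" "h' \<in> R" for g h h'
  proof -
    note a = hom_power_arr[OF sP that(1)] hom_power_arr[OF sP that(3)]
    show ?thesis
    proof (rule Sh_eqI[OF F sheafified_agree[OF s that(1,3)]])
      show "x h \<in> pobj F (Dom C g)" "x h' \<in> pobj F (Dom C g)"
        using matching_family_in[OF x] that a by metis+
      fix u assume "u \<in> agree C h h'"
      then show "pmap F u (x h) = pmap F u (x h')"
        using matching_family_map[OF x that(2), of u] matching_family_map[OF x that(4), of u] a
        by (simp add: in_agree)
    qed
  qed
  define z where "z g = x (SOME h. h \<in> R \<and> (g, h) \<in> s)" for g
  have z: "z g = x h" if "(g, h) \<in> s" "h \<in> R" for g h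
  proof -
    have "(SOME h. h \<in> R \<and> (g, h) \<in> s) \<in> R \<and> (g, SOME h. h \<in> R \<and> (g, h) \<in> s) \<in> s"
      using that by (intro someI[of "\<lambda>h. h \<in> R \<and> (g, h) \<in> s" h]) simp
    then show ?thesis using wd[OF _ _ that] unfolding z_def by blast
  qed
  have "matching_family C F ?T z"
    unfolding matching_family_def
  proof (intro conjI ballI)
    fix g assume "g \<in> ?T"
    then obtain h where h: "h \<in> R" "(g, h) \<in> s" by blast
    note a = hom_power_arr[OF sP h(2)]
    show "z g \<in> pobj F (Dom C g)" using matching_family_in[OF x h(1)] z[OF h(2,1)] a by simp
    fix u assume u: "u \<in> max_sieve C (Dom C g)"
    have "(Comp C g u, Comp C h u) \<in> s" "Comp C h u \<in> R"
      using hom_power_comp[OF sP h(2)] sieve_comp[OF R h(1)] u a by simp_all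
    then have "z (Comp C g u) = x (Comp C h u)" by (rule z)
    then show "pmap F u (z g) = z (Comp C g u)"
      using matching_family_map[OF x h(1), of u] z[OF h(2,1)] u a by simp
  qed
  then obtain y where y: "y \<in> pobj F d" "\<And>g. g \<in> ?T \<Longrightarrow> pmap F g y = z g"
    by (rule Sh_glue[OF F sheafified_cover[OF s]]) blast
  have "glues F R x s y"
    unfolding glues_def
  proof (intro allI impI)
    fix g h assume gh: "(g, h) \<in> s" "h \<in> R"
    then show "pmap F g y = x h" using y(2)[of g] z[OF gh] by auto
  qed
  with y(1) show ?thesis by blast
qed

text \<open>One half of the universal property of sheafification and Yoneda: matching families on \<open>R\<close> induce maps out of the
  sheafification of \<open>R\<close>.\<close>

lemma sheafified_hom_exists:
  assumes F: "F \<in> Sh C J" and R: "sieve C c R" and x: "matching_family C F R x"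
  obtains \<theta> where "\<theta> \<in> nat_trans C ((hom_power c)\<lparr>pobj := sheafified_sieve C J c R\<rparr>) F"
    and "\<And>d s. d \<in> Obj C \<Longrightarrow> s \<in> sheafified_sieve C J c R d \<Longrightarrow> glues F R x s (\<theta> d s)"
proof -
  let ?A = "sheafified_sieve C J c R"
  define t where "t d s = (SOME y. y \<in> pobj F d \<and> glues F R x s y)" for d s
  have t: "t d s \<in> pobj F d" "glues F R x s (t d s)" if "s \<in> ?A d" for d s
  proof -
    have "\<exists>y. y \<in> pobj F d \<and> glues F R x s y" using glues_exists[OF F R x that] by blast
    from someI_ex[OF this] show "t d s \<in> pobj F d" "glues F R x s (t d s)" by (simp_all add: t_def)
  qed
  note psh = Sh_presheaf[OF F] and A = subsheaf_stable[OF sheafified_subsheaf[OF R]]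
  let ?\<theta> = "\<lambda>d\<in>Obj C. \<lambda>s\<in>pobj ((hom_power c)\<lparr>pobj := ?A\<rparr>) d. t d s"
  have "?\<theta> \<in> nat_trans C ((hom_power c)\<lparr>pobj := ?A\<rparr>) F"
  proof (rule nat_transI)
    fix f s assume f: "f \<in> Arr C" and "s \<in> pobj ((hom_power c)\<lparr>pobj := ?A\<rparr>) (Cod C f)"
    then have s: "s \<in> ?A (Cod C f)" by simp
    have "t (Dom C f) (pmap (hom_power c) f s) = pmap F f (t (Cod C f) s)"
    proof (rule glues_unique[OF F A[OF f s] t[OF A[OF f s]]])
      show "pmap F f (t (Cod C f) s) \<in> pobj F (Dom C f)" by (rule psh_in[OF psh f t(1)[OF s]])
      show "glues F R x (pmap (hom_power c) f s) (pmap F f (t (Cod C f) s))"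
        unfolding glues_def
      proof (intro allI impI)
        fix g h assume gh: "(g, h) \<in> pmap (hom_power c) f s" and h: "h \<in> R"
        then have g: "g \<in> Arr C" "Cod C g = Dom C f" "(Comp C f g, h) \<in> s" by simp_all
        show "pmap F g (pmap F f (t (Cod C f) s)) = x h"
          using psh_comp[OF psh f g(1,2) t(1)[OF s]] gluesD[OF t(2)[OF s] g(3) h] by simp
      qed
    qed
    then show "t (Dom C f) (pmap ((hom_power c)\<lparr>pobj := ?A\<rparr>) f s) = pmap F f (t (Cod C f) s)" by simp
  qed (use t(1) A in simp_all)
  moreover have "glues F R x s (?\<theta> d s)" if "d \<in> Obj C" "s \<in> ?A d" for d s
    using t(2)[OF that(2)] that by simp
  ultimately show thesis by (rule that)
qed

text \<open>The sheafification of a dense sieve \<open>R\<close> is dense in the sheafified representable. So the map induced by a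
  matching family on \<open>R\<close> extends, and the value of the extension at the generic element is an amalgamation.
  Two amalgamations induce maps out of the representable that extend the same map, hence are equal.\<close>

lemma sh_sub_subset_Sh_dense_sieves:
  fixes F :: "('o, 'a, 'v) psh"
  assumes j: "local_operator C J j" and \<iota>: "inj (\<iota> :: ('a \<times> 'a) set \<Rightarrow> 'v)"
    and F: "F \<in> sh_sub C J j"
  shows "F \<in> Sh C (dense_sieves C J j)"
proof -
  let ?K = "dense_sieves C J j"
  interpret K: site C ?K by unfold_locales (rule dense_sieves_topology[OF j])
  have FJ: "F \<in> Sh C J" using F by (simp add: sh_sub_def)
  note psh = Sh_presheaf[OF FJ]
  let ?A = "\<lambda>c R. sheafified_sieve C J c R" and ?u = "generic_element C J"
  have extend: "\<exists>!k. k \<in> nat_trans C (hom_sheaf c) F \<and> (\<forall>d\<in>Obj C. \<forall>s\<in>?A c R d. k d s = \<theta> d s)"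
    if R: "(c, R) \<in> ?K" and \<theta>: "\<theta> \<in> nat_trans C ((hom_power c)\<lparr>pobj := ?A c R\<rparr>) F" for c R \<theta>
  proof (rule sh_sub_extend[OF F \<iota> hom_sheaf_Sh sheafified_subsheaf_hom[OF K.cover_sieve[OF R]]
        sheafified_dense[OF j R]])
    show "\<theta> \<in> nat_trans C ((hom_sheaf c)\<lparr>pobj := ?A c R\<rparr>) F" using \<theta> by simp
  qed
  show ?thesis
  proof (rule K.ShI[OF psh])
    fix c R y y' assume R: "(c, R) \<in> ?K" and y: "y \<in> pobj F c" and y': "y' \<in> pobj F c"
      and eq: "\<And>f. f \<in> R \<Longrightarrow> pmap F f y = pmap F f y'"
    note sR = K.cover_sieve[OF R] and c = K.cover_obj[OF R]
    let ?M = "max_sieve C c"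
    from sheafified_hom_exists[OF FJ sieve_max matching_family_element[OF psh sieve_max y]]
    obtain k where k: "k \<in> nat_trans C (hom_sheaf c) F"
      "\<And>d s. d \<in> Obj C \<Longrightarrow> s \<in> ?A c ?M d \<Longrightarrow> glues F ?M (\<lambda>f. pmap F f y) s (k d s)" by blast
    from sheafified_hom_exists[OF FJ sieve_max matching_family_element[OF psh sieve_max y']]
    obtain k' where k': "k' \<in> nat_trans C (hom_sheaf c) F"
      "\<And>d s. d \<in> Obj C \<Longrightarrow> s \<in> ?A c ?M d \<Longrightarrow> glues F ?M (\<lambda>f. pmap F f y') s (k' d s)" by blast
    from sheafified_hom_exists[OF FJ sR matching_family_element[OF psh sR y]]
    obtain \<theta> where \<theta>: "\<theta> \<in> nat_trans C ((hom_power c)\<lparr>pobj := ?A c R\<rparr>) F"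
      "\<And>d s. d \<in> Obj C \<Longrightarrow> s \<in> ?A c R d \<Longrightarrow> glues F R (\<lambda>f. pmap F f y) s (\<theta> d s)" by blast
    have restrict: "l d s = \<theta> d s"
      if l: "l \<in> nat_trans C (hom_sheaf c) F"
        and gl: "\<And>d s. d \<in> Obj C \<Longrightarrow> s \<in> ?A c ?M d \<Longrightarrow> glues F ?M x s (l d s)"
        and x: "\<And>f. f \<in> R \<Longrightarrow> x f = pmap F f y" and d: "d \<in> Obj C" and s: "s \<in> ?A c R d" for l x d s
    proof (rule glues_unique[OF FJ s])
      have sM: "s \<in> ?A c ?M d" using sheafified_subset[OF sR] s by blast
      show "l d s \<in> pobj F d" using nat_trans_in[OF l d] sM by simp
      show "\<theta> d s \<in> pobj F d" using nat_trans_in[OF \<theta>(1) d] s by simp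
      show "glues F R (\<lambda>f. pmap F f y) s (\<theta> d s)" by (rule \<theta>(2)[OF d s])
      show "glues F R (\<lambda>f. pmap F f y) s (l d s)"
        unfolding glues_def
      proof (intro allI impI)
        fix g h assume "(g, h) \<in> s" "h \<in> R"
        then show "pmap F g (l d s) = pmap F h y"
          using gluesD[OF gl[OF d sM], of g h] sieve_arr[OF sR, of h] x[of h] by simp
      qed
    qed
    \<comment> \<open>Both extend \<open>\<theta>\<close>, as \<open>y\<close> and \<open>y'\<close> agree on \<open>R\<close>.\<close>
    have "k = k'"
      using the1_equality[OF extend[OF R \<theta>(1)], of k] the1_equality[OF extend[OF R \<theta>(1)], of k']
        k(1) k'(1) restrict[OF k] restrict[OF k'] eq by simp
    have val: "l c (?u c) = w" if l: "l \<in> nat_trans C (hom_sheaf c) F"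
      and gl: "glues F ?M (\<lambda>f. pmap F f w) (?u c) (l c (?u c))" and w: "w \<in> pobj F c" for l w
    proof -
      have "(Id C c, Id C c) \<in> ?u c" using generic_element_diag[of "Id C c" c] c by simp
      from gluesD[OF gl this] have "pmap F (Id C c) (l c (?u c)) = pmap F (Id C c) w" using c by simp
      then show ?thesis
        using psh_id[OF psh c] w nat_trans_in[OF l c] generic_element_in[OF c] by simp
    qed
    note u = generic_element_in[OF c]
    show "y = y'"
      using val[OF k(1) k(2)[OF c u] y] val[OF k'(1) k'(2)[OF c u] y'] \<open>k = k'\<close> by simp
  next
    fix c R x assume R: "(c, R) \<in> ?K" and x: "matching_family C F R x"
    note sR = K.cover_sieve[OF R] and c = K.cover_obj[OF R]
    note u = generic_element_in[OF c]
    from sheafified_hom_exists[OF FJ sR x]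
    obtain \<theta> where \<theta>: "\<theta> \<in> nat_trans C ((hom_power c)\<lparr>pobj := ?A c R\<rparr>) F"
      "\<And>d s. d \<in> Obj C \<Longrightarrow> s \<in> ?A c R d \<Longrightarrow> glues F R x s (\<theta> d s)" by blast
    from extend[OF R \<theta>(1)] obtain k where k: "k \<in> nat_trans C (hom_sheaf c) F"
      "\<And>d s. d \<in> Obj C \<Longrightarrow> s \<in> ?A c R d \<Longrightarrow> k d s = \<theta> d s" by (elim ex1E) blast
    have "pmap F f (k c (?u c)) = x f" if f: "f \<in> R" for f
    proof -
      have fa: "f \<in> Arr C" "Cod C f = c" "Dom C f \<in> Obj C" using sieve_arr[OF sR f] by auto
      let ?s = "pmap (hom_power c) f (?u c)"
      have s: "?s \<in> ?A c R (Dom C f)" by (rule generic_element_restrict[OF sR f])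
      have "pmap F f (k c (?u c)) = \<theta> (Dom C f) ?s"
        using nat_trans_natural[OF k(1) fa(1), of "?u c"] k(2)[OF fa(3) s] u fa by simp
      also have "\<dots> = pmap F (Id C (Dom C f)) (\<theta> (Dom C f) ?s)"
        using psh_id[OF psh fa(3)] nat_trans_in[OF \<theta>(1) fa(3)] s by simp
      also have "\<dots> = x f" by (rule gluesD[OF \<theta>(2)[OF fa(3) s] generic_element_diag[OF fa(1,2)] f])
      finally show ?thesis .
    qed
    moreover have "k c (?u c) \<in> pobj F c" using nat_trans_in[OF k(1) c] u by simp
    ultimately show "\<exists>y\<in>pobj F c. \<forall>f\<in>R. pmap F f y = x f" by blast
  qed
qed

end

theorem mainTheorem7:
  fixes C :: "('o, 'a) cat"
    and J :: "('o \<times> 'a set) set"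
    and n :: nat and \<phi> :: "nat fm" and L :: "nat fm set"
  assumes "category C"
    and "grothendieck_topology C J"
    and "presents_intermediate_logic n \<phi> L"
    and "large_enough TYPE('v) TYPE('a)"
  shows "(\<exists>!j. is_L_topology C J n \<phi> j) \<and>
    (\<forall>j. is_L_topology C J n \<phi> j \<longrightarrow>
      (\<forall>K. corresponds TYPE('v) C J j K \<longleftrightarrow>
        K = generated_topology C J
          {(c, f_map C J n \<phi> c Ss) | c Ss.
             c \<in> Obj C \<and> length Ss = n \<and> (\<forall>S\<in>set Ss. closed_sieve C J c S)}))"
proof -
  interpret category C by fact
  interpret site C J by unfold_locales fact
  have \<phi>: "vars \<phi> \<subseteq> {..<n}" using assms(3) by (simp add: presents_intermediate_logic_def)
  obtain \<iota> :: "('a \<times> 'a) set \<Rightarrow> 'v" where \<iota>: "inj \<iota>"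
    using assms(4) by (auto simp: large_enough_def)
  let ?G = "{(c, f_map C J n \<phi> c Ss) | c Ss.
             c \<in> Obj C \<and> length Ss = n \<and> (\<forall>S\<in>set Ss. closed_sieve C J c S)}"
  let ?K = "generated_topology C J ?G"
  have G: "c \<in> Obj C \<and> sieve C c R" if "(c, R) \<in> ?G" for c R
  proof -
    from that obtain Ss where c: "c \<in> Obj C" and Ss: "length Ss = n" "\<forall>S\<in>set Ss. closed_sieve C J c S"
      and R: "R = f_map C J n \<phi> c Ss" by blast
    have "R = interp C J c Ss \<phi>" using c Ss R by (simp add: f_map_def pobj_power_Omega)
    then show ?thesis using interp_closed[of c Ss \<phi>] c Ss \<phi> by (simp add: closed_sieve_def)
  qed
  have K: "grothendieck_topology C ?K"
    by (rule generated_topology_topology[OF assms(1)]) (use G cover_obj cover_sieve in blast)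
  have JK: "J \<subseteq> ?K" and GK: "?G \<subseteq> ?K"
    unfolding generated_topology_def by (rule Inter_greatest, simp)+
  have least: "?K \<subseteq> K'" if "grothendieck_topology C K'" "J \<subseteq> K'" "?G \<subseteq> K'" for K'
    unfolding generated_topology_def by (rule Inter_lower) (use that in simp)
  define j where "j = closure_operator C J ?K"
  have j: "local_operator C J j" unfolding j_def by (rule closure_operator_local[OF K JK])
  have jK: "dense_sieves C J j = ?K" unfolding j_def by (rule dense_sieves_closure_operator[OF K JK])
  have dense: "equalizer_dense C J n \<phi> j' \<longleftrightarrow> dense_sieves C J j \<subseteq> dense_sieves C J j'"
    if j': "local_operator C J j'" for j'
    unfolding equalizer_dense_iff[OF j' \<phi>] jK
    by (rule iffI[OF least[OF dense_sieves_topology[OF j'] subset_dense_sieves[OF j']] subset_trans[OF GK]])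
  have Lj: "is_L_topology C J n \<phi> j"
    using j dense[OF j] by (auto simp: is_L_topology_def dense local_operator_le_iff)
  have unique: "j' = j" if "is_L_topology C J n \<phi> j'" for j'
  proof -
    have j': "local_operator C J j'" and d: "equalizer_dense C J n \<phi> j'"
      and le: "local_operator_le C J j' j"
      using that Lj by (simp_all add: is_L_topology_def)
    have "dense_sieves C J j' = dense_sieves C J j"
      using local_operator_le_iff[OF j' j] le dense[OF j'] d by (intro equalityI) simp_all
    then show ?thesis by (rule local_operator_eqI[OF j' j])
  qed
  have Sh: "(Sh C ?K :: ('o, 'a, 'v) psh set) = sh_sub C J j"
    unfolding jK[symmetric]
    by (intro equalityI Sh_dense_sieves_subset[OF j] subsetI sh_sub_subset_Sh_dense_sieves[OF j \<iota>])
  \<comment> \<open>Sieves, as elements of the power object of the terminal presheaf, are coded by diagonal relations.\<close>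
  have inj: "inj (\<lambda>s :: ('a \<times> unit) set. \<iota> ((\<lambda>(a, _). (a, a)) ` s))"
  proof (rule injI)
    fix s t :: "('a \<times> unit) set"
    assume "\<iota> ((\<lambda>(a, _). (a, a)) ` s) = \<iota> ((\<lambda>(a, _). (a, a)) ` t)"
    then have "(\<lambda>(a, _). (a, a)) ` s = (\<lambda>(a, _). (a, a)) ` t" using \<iota> by (simp add: inj_eq)
    moreover have "inj (\<lambda>(a :: 'a, _ :: unit). (a, a))" by (auto simp: inj_def)
    ultimately show "s = t" by (simp only: inj_image_eq_iff)
  qed
  have corr: "corresponds TYPE('v) C J j K' \<longleftrightarrow> K' = ?K" for K'
  proof
    assume "corresponds TYPE('v) C J j K'"
    then have K': "grothendieck_topology C K'" and eq: "(Sh C K' :: ('o, 'a, 'v) psh set) = Sh C ?K"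
      unfolding Sh by (simp_all add: corresponds_def)
    show "K' = ?K"
      using topology_subset_if_Sh_subset[OF assms(1) K' K _ inj]
        topology_subset_if_Sh_subset[OF assms(1) K K' _ inj] eq by simp
  next
    assume "K' = ?K"
    then show "corresponds TYPE('v) C J j K'" using K JK Sh by (simp add: corresponds_def)
  qed
  show ?thesis
  proof (intro conjI allI impI)
    show "\<exists>!j. is_L_topology C J n \<phi> j" using Lj unique by (rule ex1I)
    fix j' K' assume "is_L_topology C J n \<phi> j'"
    then show "corresponds TYPE('v) C J j' K' \<longleftrightarrow> K' = ?K" using unique corr by simp
  qed
qed

end
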